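(* Let $\bm C\in\mathbb S^d_{++}$, $\bm A=[\bm a_1,\dots,\bm a_n]\in\mathbb R^{d\times n}$, let $s$ be a positive integer with $s<n$, and $$z^*:=\max_{S\subseteq[n],\,|S|=s}\log\det\Big(\bm C+\sum_{i\in S}\bm a_i\bm a_i^\top\Big).$$ Let $\hat z_R,\hat z_M,\hat z_M^c$ be the continuous-relaxation values defined in the context, let $x_{\min}>0$ be the least non-zero entry of an optimal solution $\hat{\bm x}_D$ of the relaxation defining $\hat z_R$, and let $\delta:=\lambda_{\max}(\bm A^\top\bm C^{-1}\bm A)$. Then $$z^*\le\hat z_R\le z^*-n\log(x_{\min})+(n-s)\log(1+\delta),$$ $$z^*\le\hat z_M\le z^*+s\log\Big(\frac sn\Big)+\log\binom ns,$$ $$z^*\le\hat z_M^c\le z^*+(n-s)\log\Big(\frac{n-s}n\Big)+\log\binom n{n-s}.$$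
   Context: $[n]=\{1,\dots,n\}$; $\mathbb S^d_{++}$ is the set of symmetric positive-definite $d\times d$ matrices. Put $\bm b_i:=\bm C^{-1/2}\bm a_i$ (positive-definite square root), $\bm B:=[\bm b_1,\dots,\bm b_n]$; let $\bm I_n+\bm B^\top\bm B=\bm V^\top\bm V$ and $(\bm I_n+\bm B^\top\bm B)^{-1}=\bm W^\top\bm W$ be Cholesky factorizations, with $i$-th columns $\bm v_i$ and $\bm w_i$. For $1\le r\le n$ and a symmetric positive-semidefinite $n\times n$ matrix $\bm X$ with eigenvalues $\lambda_1\ge\cdots\ge\lambda_n\ge0$, $f_r(\bm X)=\prod_{i=1}^k\lambda_i\cdot\big(\frac1{r-k}\sum_{i=k+1}^n\lambda_i\big)^{r-k}$, where $k$ is the unique integer with $0\le k<r$ and $\lambda_k>\frac1{r-k}\sum_{i=k+1}^n\lambda_i\ge\lambda_{k+1}$ ($\lambda_0=+\infty$). $\hat z_R:=\log\det\bm C+\max\{\log\det(\bm I_d+\sum_i x_i\bm b_i\bm b_i^\top):\bm x\in[0,1]^n,\sum_i x_i=s\}$. $\hat z_M:=\log\det\bm C+\max\{\log f_s(\sum_i x_i\bm v_i\bm v_i^\top):\bm x\in[0,1]^n,\sum_i x_i=s\}$. $\hat z_M^c:=\log\det(\bm C+\bm A\bm A^\top)+\max\{\log f_{n-s}(\sum_i x_i\bm w_i\bm w_i^\top):\bm x\in[0,1]^n,\sum_i x_i=n-s\}$. *)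

theory Defs
  imports "HOL-Analysis.Analysis"
begin

definition posdef :: "real^'m^'m \<Rightarrow> bool" where
  "posdef M \<longleftrightarrow> transpose M = M \<and> (\<forall>v. v \<noteq> 0 \<longrightarrow> v \<bullet> (M *v v) > 0)"

definition posdef_sqrt :: "real^'m^'m \<Rightarrow> real^'m^'m" where
  "posdef_sqrt M = (THE R. posdef R \<and> R ** R = M)"

(* v v\<^sup>T, for a column vector v *)
definition outer_prod :: "real^'m \<Rightarrow> real^'m^'m" where
  "outer_prod v = (columnvector v :: real^1^'m) ** (rowvector v :: real^'m^1)"

(* The factor is normalised to have a positive diagonal, which makes it unique. *)
definition cholesky_factor ::
    "real^('n::{finite,linorder})^('n::{finite,linorder}) \<Rightarrow>
     real^('n::{finite,linorder})^('n::{finite,linorder}) \<Rightarrow> bool"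
  where "cholesky_factor M V \<longleftrightarrow>
     (\<forall>i j. j < i \<longrightarrow> V $ i $ j = 0) \<and> (\<forall>i. 0 < V $ i $ i) \<and> M = transpose V ** V"

(* The roots of the characteristic polynomial det (t I - X), repeated according to
   multiplicity and in decreasing order; meaningful for symmetric X, all of whose
   eigenvalues are real. *)
definition eigenvalue_list :: "real^'m^'m \<Rightarrow> real list" where
  "eigenvalue_list X =
     (THE ls. sorted_wrt (\<ge>) ls \<and> (\<forall>t. det (mat t - X) = (\<Prod>l\<leftarrow>ls. t - l)))"

(* eigval X i is the i-th largest eigenvalue, for 1 \<le> i \<le> CARD('m) *)
definition eigval :: "real^'m^'m \<Rightarrow> nat \<Rightarrow> real" where
  "eigval X i = eigenvalue_list X ! (i - 1)"

definition tail_avg :: "nat \<Rightarrow> real^'m^'m \<Rightarrow> nat \<Rightarrow> real" where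
  "tail_avg r X k = 1 / real (r - k) * (\<Sum>i = k+1..CARD('m). eigval X i)"

(* The disjunct k = 0 encodes the convention that the 0-th eigenvalue is +\<infinity>. *)
definition split_index :: "nat \<Rightarrow> real^'m^'m \<Rightarrow> nat" where
  "split_index r X =
     (THE k. k < r \<and> (k = 0 \<or> eigval X k > tail_avg r X k) \<and> tail_avg r X k \<ge> eigval X (k+1))"

definition f_fun :: "nat \<Rightarrow> real^'m^'m \<Rightarrow> real" where
  "f_fun r X = (let k = split_index r X in
     (\<Prod>i = 1..k. eigval X i) * tail_avg r X k ^ (r - k))"

definition max_on :: "'a set \<Rightarrow> ('a \<Rightarrow> real) \<Rightarrow> real" where
  "max_on S g = (GREATEST z. z \<in> g ` S)"

definition feasible :: "nat \<Rightarrow> (real^'n) set" where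
  "feasible r = {x. (\<forall>i. 0 \<le> x $ i \<and> x $ i \<le> 1) \<and> (\<Sum>i\<in>UNIV. x $ i) = real r}"

definition z_star :: "real^'d^'d \<Rightarrow> real^'n^'d \<Rightarrow> nat \<Rightarrow> real" where
  "z_star C A s =
     Max ((\<lambda>S. ln (det (C + (\<Sum>i\<in>S. outer_prod (column i A))))) ` {S. card S = s})"

definition B_mat :: "real^'d^'d \<Rightarrow> real^'n^'d \<Rightarrow> real^'n^'d" where
  "B_mat C A = matrix_inv (posdef_sqrt C) ** A"

definition M_mat :: "real^'d^'d \<Rightarrow> real^'n^'d \<Rightarrow> real^'n^'n" where
  "M_mat C A = mat 1 + transpose (B_mat C A) ** B_mat C A"

definition obj_R :: "real^'d^'d \<Rightarrow> real^'n^'d \<Rightarrow> real^'n \<Rightarrow> real" where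
  "obj_R C A x = ln (det (mat 1 + (\<Sum>i\<in>UNIV. x $ i *\<^sub>R outer_prod (column i (B_mat C A)))))"

definition z_R :: "real^'d^'d \<Rightarrow> real^'n^'d \<Rightarrow> nat \<Rightarrow> real" where
  "z_R C A s = ln (det C) + max_on (feasible s) (obj_R C A)"

(* For invertible U the matrix below has rank at least r at every feasible point, so
   its f_fun value is positive and the logarithm is a genuine one. *)
definition max_log_f :: "nat \<Rightarrow> real^'n^'n \<Rightarrow> real" where
  "max_log_f r U = max_on (feasible r)
     (\<lambda>x. ln (f_fun r (\<Sum>i\<in>UNIV. x $ i *\<^sub>R outer_prod (column i U))))"

(* V is the Cholesky factor of M_mat C A *)
definition z_M :: "real^'d^'d \<Rightarrow> real^'n^'n \<Rightarrow> nat \<Rightarrow> real" where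
  "z_M C V s = ln (det C) + max_log_f s V"

(* W is the Cholesky factor of the inverse of M_mat C A *)
definition z_Mc :: "real^'d^'d \<Rightarrow> real^'n^'d \<Rightarrow> real^'n^'n \<Rightarrow> nat \<Rightarrow> real" where
  "z_Mc C A W s = ln (det (C + A ** transpose A)) + max_log_f (CARD('n) - s) W"

definition min_nonzero_entry :: "real^'n \<Rightarrow> real" where
  "min_nonzero_entry x = Min {x $ i | i. x $ i \<noteq> 0}"

end

theory Submission
  imports Defs
begin

text \<open>
  Let \<open>G = V\<^sup>T V\<close>, let \<open>g(S)\<close> be its principal minors and put
  \<open>x(S) = \<Prod>\<^bsub>i \<in> S\<^esub> x\<^sub>i\<close>. Expanding
  \<open>det (u I - V diag(x) V\<^sup>T) = det (u I - diag(x) G)\<close> row by row and comparing coefficients of \<open>u\<close>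
  gives \<open>e\<^sub>r(\<lambda>) = \<Sum>\<^bsub>|S| = r\<^esub> x(S) g(S)\<close> for the spectrum \<open>\<lambda>\<close> of the weighted Gram matrix.
  Always \<open>f\<^sub>r(\<lambda>) \<le> e\<^sub>r(\<lambda>)\<close>, because \<open>e\<^sub>m(y) \<ge> \<Sum> y\<^sub>i - m + 1\<close> for \<open>y\<close> in the unit cube; equality
  holds if the rank is at most \<open>r\<close>, so \<open>f\<^sub>r\<close> equals \<open>g(S)\<close> at the indicator of an \<open>r\<close>-set \<open>S\<close>.
  Maclaurin's inequality bounds \<open>\<Sum>\<^bsub>|S| = r\<^esub> x(S)\<close> by \<open>(n choose r) (r/n)\<^sup>r\<close>.
  For \<open>G = I + B\<^sup>T B\<close> Sylvester's identity turns \<open>g(S)\<close> into the combinatorial objective, and the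
  minors of the inverse of \<open>G\<close> are the complementary minors of \<open>G\<close> divided by \<open>det G\<close>.
  The bound for the natural relaxation is cruder: \<open>- n ln x\<^sub>m\<^sub>i\<^sub>n \<ge> 0\<close>, and enlarging all \<open>x\<^sub>i\<close> to 1
  and then dropping \<open>n - s\<close> rank-one terms loses at most a factor \<open>1 + \<delta>\<close> for each of them.
\<close>

subsection \<open>Determinants\<close>

lemma sum_Pow_insert:
  assumes "finite F" "k \<notin> F"
  shows "sum f (Pow (insert k F)) = sum f (Pow F) + (\<Sum>T\<in>Pow F. f (insert k T))"
proof -
  have "inj_on (insert k) (Pow F)" using assms by (intro inj_onI) (auto 4 3)
  moreover have "Pow F \<inter> insert k ` Pow F = {}" using assms by auto
  ultimately show ?thesis
    using assms by (simp add: Pow_insert sum.union_disjoint sum.reindex)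
qed

text \<open>Multilinearity in the rows, by induction on \<open>F\<close>. Splitting row
  \<open>k\<close> leaves a determinant of the same shape in which that row is fixed, so the
  induction hypothesis is used with \<open>c\<close> updated at \<open>k\<close>; hence the
  generalisation over \<open>c\<close>.\<close>

lemma det_row_plus_expand_on:
  fixes a b c :: "'n::finite \<Rightarrow> real^'n"
  assumes "finite F"
  shows "det (\<chi> i. if i \<in> F then a i + b i else c i)
    = (\<Sum>T\<in>Pow F. det (\<chi> i. if i \<in> T then b i else if i \<in> F then a i else c i))"
  using assms
proof (induction F arbitrary: c rule: finite_induct)
  case (insert k F)
  let ?r = "\<lambda>T c i. if i \<in> T then b i else if i \<in> F then a i else c i"
  have step: "det (\<chi> i. if i \<in> F then a i + b i else (c(k := v)) i)
      = (\<Sum>T\<in>Pow F. det (\<chi> i. ?r T (c(k := v)) i))" for v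
    by (rule insert.IH)
  have "det (\<chi> i. if i \<in> insert k F then a i + b i else c i)
      = det (\<chi> i. if i = k then a k + b k else if i \<in> F then a i + b i else c i)"
    by (rule arg_cong[where f = det]) (auto simp: vec_eq_iff)
  also have "\<dots> = det (\<chi> i. if i \<in> F then a i + b i else (c(k := a k)) i)
      + det (\<chi> i. if i \<in> F then a i + b i else (c(k := b k)) i)"
    using insert.hyps by (subst det_row_add) (auto intro!: arg_cong2[where f = "(+)"] arg_cong[where f = det] simp: vec_eq_iff)
  also have "\<dots> = (\<Sum>T\<in>Pow F. det (\<chi> i. if i \<in> T then b i else if i \<in> insert k F then a i else c i))
      + (\<Sum>T\<in>Pow F. det (\<chi> i. if i \<in> insert k T then b i else if i \<in> insert k F then a i else c i))"
    unfolding step using insert.hyps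
    by (intro arg_cong2[where f = "(+)"] sum.cong refl arg_cong[where f = det])
      (auto simp: vec_eq_iff)
  finally show ?case using insert.hyps by (simp add: sum_Pow_insert)
qed simp

lemma det_row_plus_expand:
  fixes a b :: "'n::finite \<Rightarrow> real^'n"
  shows "det (\<chi> i. a i + b i) = (\<Sum>T\<in>UNIV. det (\<chi> i. if i \<in> T then b i else a i))"
  using det_row_plus_expand_on[of UNIV a b a] by (simp cong: if_cong)

lemma matrix_diff_ldistrib: "(A :: real^'n^'m) ** (B - C) = A ** B - A ** C"
  by (simp add: vec_eq_iff matrix_matrix_mult_def algebra_simps sum_subtractf)

lemma matrix_diff_rdistrib: "((A :: real^'n^'m) - B) ** C = A ** C - B ** C"
  by (simp add: vec_eq_iff matrix_matrix_mult_def algebra_simps sum_subtractf)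

lemma outer_prod_nth [simp]: "outer_prod v $ i $ j = v $ i * v $ j"
  by (simp add: outer_prod_def matrix_matrix_mult_def columnvector_def rowvector_def)

lemma outer_prod_vec: "outer_prod v *v x = (v \<bullet> x) *\<^sub>R v"
  by (simp add: vec_eq_iff matrix_vector_mult_def inner_vec_def sum_distrib_left mult_ac)

text \<open>Cramer's rule for the identity matrix: \<open>v\<close> is the combination of the
  identity rows with its own entries as coefficients.\<close>

lemma det_one_row_identity:
  "det ((\<chi> i. if i = k then v else axis i 1) :: real^'n^'n) = v $ k"
proof -
  have "v = (\<Sum>i\<in>UNIV. v $ i *s row i (mat 1 :: real^'n^'n))"
    by (simp add: vec_eq_iff row_def mat_def if_distrib[of "\<lambda>x. _ * x"] cong: if_cong)
  moreover have "axis i 1 = row i (mat 1 :: real^'n^'n)" for i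
    by (simp add: vec_eq_iff row_def mat_def axis_def)
  ultimately show ?thesis
    using cramer_lemma_transpose[where A = "mat 1 :: real^'n^'n" and x = v and k = k]
    by (simp cong: if_cong)
qed

lemma det_identity_plus_rank_one:
  fixes u v :: "real^'n"
  shows "det (mat 1 + (\<chi> i j. u $ i * v $ j)) = 1 + u \<bullet> v"
proof -
  let ?d = "\<lambda>T::'n set. det (\<chi> i. if i \<in> T then u $ i *s v else axis i 1)"
  have "mat 1 + (\<chi> i j. u $ i * v $ j) = (\<chi> i. axis i 1 + u $ i *s v)"
    by (auto simp: vec_eq_iff mat_def axis_def)
  then have "det (mat 1 + (\<chi> i j. u $ i * v $ j)) = (\<Sum>T\<in>UNIV. ?d T)"
    by (simp only: det_row_plus_expand)
  \<comment> \<open>A set \<open>T\<close> with two elements selects two multiples of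
    \<open>v\<close> as rows, so only the empty set and the singletons survive.\<close>
  also have "\<dots> = (\<Sum>T\<in>insert {} (range (\<lambda>i. {i})). ?d T)"
  proof (rule sum.mono_neutral_right)
    show "\<forall>T\<in>UNIV - insert {} (range (\<lambda>i. {i})). ?d T = 0"
    proof
      fix T :: "'n set" assume T: "T \<in> UNIV - insert {} (range (\<lambda>i. {i}))"
      then obtain i where i: "i \<in> T" "T \<noteq> {i}" by blast
      then obtain j where ij: "i \<in> T" "j \<in> T" "i \<noteq> j" by blast
      have "?d T = det (\<chi> i. (if i \<in> T then u $ i else 1) *s (if i \<in> T then v else axis i 1))"
        by (rule arg_cong[where f = det]) (auto simp: vec_eq_iff)
      also have "\<dots> = (\<Prod>i\<in>UNIV. if i \<in> T then u $ i else 1) * det (\<chi> i. if i \<in> T then v else axis i 1)"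
        by (rule det_rows_mul)
      also have "det (\<chi> i. if i \<in> T then v else axis i 1) = 0"
        by (rule det_identical_rows[of i j]) (use ij in \<open>auto simp: row_def\<close>)
      finally show "?d T = 0" by simp
    qed
  qed simp_all
  also have "\<dots> = ?d {} + (\<Sum>i\<in>UNIV. ?d {i})"
  proof -
    have "inj (\<lambda>i::'n. {i})" by (simp add: inj_def)
    then show ?thesis by (subst sum.insert) (auto simp: sum.reindex)
  qed
  also have "?d {} = 1"
  proof -
    have "(\<chi> i. axis i 1) = (mat 1 :: real^'n^'n)" by (auto simp: vec_eq_iff mat_def axis_def)
    then show ?thesis by simp
  qed
  also have "(\<Sum>i\<in>UNIV. ?d {i}) = (\<Sum>i\<in>UNIV. u $ i * v $ i)"
  proof (rule sum.cong)
    fix k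
    have "?d {k} = det (\<chi> i. if i = k then u $ k *s v else axis i 1)"
      by (rule arg_cong[where f = det]) (auto simp: vec_eq_iff)
    then show "?d {k} = u $ k * v $ k" by (simp add: det_one_row_identity)
  qed simp
  finally show ?thesis by (simp add: inner_vec_def)
qed

text \<open>The matrix determinant lemma, from the factorization of P + u v^T as P (I + w v^T). A
  solution \<open>w\<close> of the linear system stands in for the inverse of \<open>P\<close>
  applied to \<open>u\<close>.\<close>

lemma det_rank_one_update:
  fixes P :: "real^'n^'n"
  assumes "P *v w = u"
  shows "det (P + (\<chi> i j. u $ i * v $ j)) = det P * (1 + w \<bullet> v)"
proof -
  have "P + (\<chi> i j. u $ i * v $ j) = P ** (mat 1 + (\<chi> i j. w $ i * v $ j))"
    unfolding matrix_add_ldistrib matrix_mul_rid assms[symmetric]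
    by (simp add: vec_eq_iff matrix_matrix_mult_def matrix_vector_mult_def sum_distrib_right mult.assoc)
  then show ?thesis by (simp add: det_mul det_identity_plus_rank_one)
qed

subsection \<open>Spectral theorem\<close>

lemma symmetric_inner:
  fixes X :: "real^'n^'n"
  assumes "transpose X = X"
  shows "x \<bullet> (X *v y) = (X *v x) \<bullet> y"
  by (metis assms dot_lmul_matrix transpose_matrix_vector)

text \<open>A maximiser \<open>u\<close> of the quadratic form on the unit sphere of
  \<open>S\<close> is an eigenvector. The form \<open>q\<close> is nonnegative on \<open>S\<close>
  and vanishes at \<open>u\<close>, so moving from \<open>u\<close> along the residual
  \<open>w\<close> can have no first-order effect on \<open>q\<close>; that effect is 2 t |w|^2,
  whence \<open>w\<close> is zero.\<close>

lemma rayleigh_maximizer_eigenvector: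
  fixes X :: "real^'n^'n"
  assumes sym: "transpose X = X" and S: "subspace S" and inv: "\<And>x. x \<in> S \<Longrightarrow> X *v x \<in> S"
    and ne: "S \<noteq> {0}"
  obtains u \<mu> where "u \<in> S" "norm u = 1" "X *v u = \<mu> *\<^sub>R u"
proof -
  obtain y where y: "y \<in> S" "y \<noteq> 0" using S ne subspace_0 by blast
  let ?K = "S \<inter> sphere 0 1"
  have "y /\<^sub>R norm y \<in> ?K" using y S by (simp add: subspace_scale)
  then have "?K \<noteq> {}" by blast
  moreover have "compact ?K"
    using closed_subspace[OF S] compact_sphere by (simp add: closed_Int_compact)
  moreover have "continuous_on ?K (\<lambda>x. x \<bullet> (X *v x))"
    by (intro continuous_on_inner continuous_on_id linear_continuous_on matrix_vector_mul_bounded_linear)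
  ultimately obtain u where u: "u \<in> ?K" and max: "\<And>x. x \<in> ?K \<Longrightarrow> x \<bullet> (X *v x) \<le> u \<bullet> (X *v u)"
    using continuous_attains_sup[of ?K] by blast
  define \<mu> where "\<mu> = u \<bullet> (X *v u)"
  define q where "q x = \<mu> * (x \<bullet> x) - x \<bullet> (X *v x)" for x
  have q: "q x \<ge> 0" if "x \<in> S" for x
  proof (cases "x = 0")
    case False
    have "x /\<^sub>R norm x \<in> ?K" using that False S by (simp add: subspace_scale)
    from max[OF this] have "x \<bullet> (X *v x) / (norm x)\<^sup>2 \<le> \<mu>"
      by (simp add: \<mu>_def matrix_vector_mult_scaleR power2_eq_square divide_inverse mult_ac)
    then show ?thesis using False by (simp add: q_def field_simps power2_norm_eq_inner)
  qed (simp add: q_def)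
  define w where "w = \<mu> *\<^sub>R u - X *v u"
  have uS: "u \<in> S" "u \<bullet> u = 1" using u by (auto simp: norm_eq_1)
  have wS: "w \<in> S" unfolding w_def using uS S inv by (simp add: subspace_diff subspace_scale)
  have lin: "q (u + t *\<^sub>R w) = 2 * t * (w \<bullet> w) + t\<^sup>2 * q w" for t
  proof -
    have sw: "u \<bullet> (X *v w) = w \<bullet> (X *v u)"
      using symmetric_inner[OF sym, of u w] by (simp add: inner_commute)
    have ww: "\<mu> * (u \<bullet> w) = w \<bullet> w + w \<bullet> (X *v u)"
      by (subst (2) w_def) (simp add: inner_diff_right inner_commute)
    have "q (u + t *\<^sub>R w) = 2 * t * (\<mu> * (u \<bullet> w)) - 2 * t * (w \<bullet> (X *v u)) + t\<^sup>2 * q w"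
      unfolding q_def
      by (simp add: inner_add_left inner_add_right matrix_vector_right_distrib matrix_vector_mult_scaleR
          inner_commute[of w u] uS(2) \<mu>_def[symmetric] sw power2_eq_square algebra_simps)
    then show ?thesis unfolding ww by (simp add: algebra_simps)
  qed
  have "w = 0"
  proof (rule ccontr)
    assume "w \<noteq> 0"
    then have p: "w \<bullet> w > 0" by simp
    \<comment> \<open>Negative and so small that the quadratic term cannot compensate the linear
      one; adding 1 keeps the denominator positive when \<open>q w\<close> is zero.\<close>
    define t where "t = - (w \<bullet> w) / (q w + 1)"
    have qw: "q w \<ge> 0" by (rule q[OF wS])
    have "0 \<le> q (u + t *\<^sub>R w)" using q uS wS S by (simp add: subspace_add subspace_scale)
    also have "\<dots> = t * (2 * (w \<bullet> w) + t * q w)" by (simp add: lin power2_eq_square algebra_simps)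
    finally have *: "0 \<le> t * (2 * (w \<bullet> w) + t * q w)" .
    have "t < 0" using p qw by (simp add: t_def)
    moreover have "t * q w \<ge> - (w \<bullet> w)" using p qw by (simp add: t_def field_simps)
    ultimately show False using * p by (simp add: zero_le_mult_iff)
  qed
  then have "X *v u = \<mu> *\<^sub>R u" by (simp add: w_def)
  then show ?thesis using that u by auto
qed

text \<open>Take an orthonormal set of eigenvectors of largest cardinality. Its orthogonal
  complement is invariant under \<open>X\<close>, so if it were nonzero it would contain one more
  unit eigenvector.\<close>

lemma orthonormal_eigenbasis:
  fixes X :: "real^'n^'n"
  assumes sym: "transpose X = X"
  obtains B where "pairwise orthogonal B" "card B = CARD('n)" "\<And>b. b \<in> B \<Longrightarrow> norm b = 1"
    "\<And>b. b \<in> B \<Longrightarrow> \<exists>\<mu>. X *v b = \<mu> *\<^sub>R b"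
proof -
  define \<B> where "\<B> = {B. pairwise orthogonal B \<and> (\<forall>b\<in>B. norm b = 1 \<and> (\<exists>\<mu>. X *v b = \<mu> *\<^sub>R b))}"
  have ind: "independent B" if "B \<in> \<B>" for B
    by (rule pairwise_orthogonal_independent) (use that in \<open>auto simp: \<B>_def\<close>)
  have bound: "finite B \<and> card B \<le> CARD('n)" if "B \<in> \<B>" for B
    using independent_bound[OF ind[OF that]] by simp
  have "{} \<in> \<B>" by (simp add: \<B>_def)
  moreover have "\<forall>B. B \<in> \<B> \<longrightarrow> card B < Suc (CARD('n))" using bound by (auto simp: less_Suc_eq_le)
  ultimately have "\<exists>B. B \<in> \<B> \<and> (\<forall>B'. B' \<in> \<B> \<longrightarrow> card B' \<le> card B)"
    by (rule ex_has_greatest_nat[where f = card])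
  then obtain B where B: "B \<in> \<B>" and max: "\<And>B'. B' \<in> \<B> \<Longrightarrow> card B' \<le> card B"
    by blast
  have "card B = CARD('n)"
  proof (rule ccontr)
    assume "card B \<noteq> CARD('n)"
    then have "dim (span B) \<noteq> DIM(real^'n)"
      using ind[OF B] by (simp add: dim_span dim_eq_card_independent)
    then have "span B \<noteq> UNIV" by (metis dim_UNIV)
    define S where "S = {x. \<forall>b\<in>B. orthogonal b x}"
    have "S \<noteq> {0}"
    proof -
      obtain a where a: "a \<noteq> 0" "\<And>x. x \<in> span B \<Longrightarrow> orthogonal a x"
        using orthogonal_to_subspace_exists_gen[of B UNIV] \<open>span B \<noteq> UNIV\<close>
        by (metis psubsetI subset_UNIV span_UNIV)
      then show ?thesis by (auto simp: S_def orthogonal_commute span_base)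
    qed
    moreover have "subspace S"
      by (auto simp: S_def subspace_def orthogonal_clauses)
    moreover have "X *v x \<in> S" if "x \<in> S" for x
    proof -
      have "b \<bullet> (X *v x) = 0" if b: "b \<in> B" for b
      proof -
        obtain \<mu> where "X *v b = \<mu> *\<^sub>R b" using B b by (auto simp: \<B>_def)
        then show ?thesis using \<open>x \<in> S\<close> b by (simp add: symmetric_inner[OF sym] S_def orthogonal_def)
      qed
      then show ?thesis by (simp add: S_def orthogonal_def)
    qed
    ultimately obtain u \<mu> where u: "u \<in> S" "norm u = 1" "X *v u = \<mu> *\<^sub>R u"
      using rayleigh_maximizer_eigenvector[OF sym] by metis
    have "insert u B \<in> \<B>"
      using u B by (auto simp: \<B>_def pairwise_insert S_def orthogonal_commute)
    moreover have "u \<notin> B"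
    proof
      assume "u \<in> B"
      then have "u \<bullet> u = 0" using u by (auto simp: S_def orthogonal_def)
      then show False using u by simp
    qed
    ultimately show False using max[of "insert u B"] bound[OF B] by simp
  qed
  then show ?thesis using that B by (auto simp: \<B>_def)
qed

definition diag :: "real^'n \<Rightarrow> real^'n^'n" where
  "diag d = (\<chi> i j. if i = j then d $ i else 0)"

lemma spectral_decomposition:
  fixes X :: "real^'n^'n"
  assumes sym: "transpose X = X"
  obtains Q d where "orthogonal_matrix Q" "X = Q ** diag d ** transpose Q"
proof -
  obtain B where B: "pairwise orthogonal B" "card B = CARD('n)" "\<And>b. b \<in> B \<Longrightarrow> norm b = 1"
    "\<And>b. b \<in> B \<Longrightarrow> \<exists>\<mu>. X *v b = \<mu> *\<^sub>R b"
    using orthonormal_eigenbasis[OF sym] by metis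
  have "finite B" using B(2) by (metis card.infinite zero_less_card_finite less_numeral_extra(3))
  then obtain h where h: "bij_betw h (UNIV :: 'n set) B"
    using finite_same_card_bij[of "UNIV :: 'n set" B] B(2) by auto
  then have hB: "h i \<in> B" for i by (auto simp: bij_betw_def)
  have hne: "h i \<noteq> h j" if "i \<noteq> j" for i j using h that by (auto simp: bij_betw_def inj_def)
  define Q :: "real^'n^'n" where "Q = (\<chi> i j. h j $ i)"
  have "\<forall>i. \<exists>\<mu>. X *v h i = \<mu> *\<^sub>R h i" using B(4) hB by blast
  then obtain d where d: "\<And>i. X *v h i = d i *\<^sub>R h i" unfolding choice_iff by blast
  have Q: "orthogonal_matrix Q"
    unfolding orthogonal_matrix_orthonormal_columns
    using B(1,3) hB hne by (auto simp: Q_def column_def vec_nth_inverse pairwise_def)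
  have "X ** Q = Q ** diag (\<chi> i. d i)"
  proof (simp add: vec_eq_iff, intro allI)
    fix i j
    have "(X ** Q) $ i $ j = (X *v h j) $ i"
      by (simp add: matrix_matrix_mult_def matrix_vector_mult_def Q_def)
    also have "\<dots> = h j $ i * d j" by (simp add: d)
    also have "\<dots> = (Q ** diag (\<chi> i. d i)) $ i $ j"
      by (simp add: matrix_matrix_mult_def Q_def diag_def if_distrib[of "\<lambda>x. _ * x"] cong: if_cong)
    finally show "(X ** Q) $ i $ j = (Q ** diag (\<chi> i. d i)) $ i $ j" .
  qed
  then have "X ** (Q ** transpose Q) = Q ** diag (\<chi> i. d i) ** transpose Q"
    by (simp add: matrix_mul_assoc)
  then show ?thesis using that Q by (simp add: orthogonal_matrix_def)
qed

lemma det_diag: "det (diag d) = (\<Prod>i\<in>UNIV. d $ i)"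
  by (subst det_diagonal) (auto simp: diag_def)

lemma diag_vec: "diag d *v x = (\<chi> i. d $ i * x $ i)"
  by (simp add: vec_eq_iff matrix_vector_mult_def diag_def if_distrib[of "\<lambda>x. x * _"] cong: if_cong)

lemma charpoly_diagonalized:
  assumes "orthogonal_matrix Q"
  shows "det (mat t - Q ** diag d ** transpose Q) = (\<Prod>i\<in>UNIV. t - d $ i)"
proof -
  have Q: "Q ** transpose Q = mat 1" using assms by (simp add: orthogonal_matrix_def)
  have m: "mat t = diag (\<chi> i. t)" by (simp add: vec_eq_iff mat_def diag_def)
  have c: "Q ** mat t = mat t ** Q"
    by (simp add: vec_eq_iff matrix_matrix_mult_def mat_def if_distrib[of "\<lambda>x. _ * x"] if_distrib[of "\<lambda>x. x * _"] mult.commute cong: if_cong)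
  have "Q ** (mat t - diag d) ** transpose Q = mat t ** (Q ** transpose Q) - Q ** diag d ** transpose Q"
    by (simp add: matrix_diff_ldistrib matrix_diff_rdistrib c matrix_mul_assoc)
  then have "mat t - Q ** diag d ** transpose Q = Q ** (mat t - diag d) ** transpose Q"
    by (simp add: Q)
  then have "det (mat t - Q ** diag d ** transpose Q) = det (Q ** transpose Q) * det (mat t - diag d)"
    by (simp add: det_mul)
  also have "mat t - diag d = diag (\<chi> i. t - d $ i)"
    by (simp add: vec_eq_iff mat_def diag_def)
  finally show ?thesis by (simp add: Q det_diag)
qed

text \<open>Stated for arbitrary \<open>Q\<close>, so that it serves spectral decompositions and
  weighted Gram matrices alike.\<close>

lemma diagonalized_inner:
  "x \<bullet> ((Q ** diag d ** transpose Q) *v x) = (\<Sum>i\<in>UNIV. d $ i * ((transpose Q *v x) $ i)\<^sup>2)"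
proof -
  have "x \<bullet> ((Q ** diag d ** transpose Q) *v x) = (transpose Q *v x) \<bullet> (diag d *v (transpose Q *v x))"
    by (metis (no_types, lifting) dot_lmul_matrix matrix_vector_mul_assoc transpose_matrix_vector transpose_transpose)
  also have "\<dots> = (\<Sum>i\<in>UNIV. d $ i * ((transpose Q *v x) $ i)\<^sup>2)"
    by (simp add: inner_vec_def diag_vec power2_eq_square mult_ac)
  finally show ?thesis .
qed

subsection \<open>Eigenvalues\<close>

text \<open>Both sides are values of polynomials; agreeing at every real, the polynomials coincide,
  and \<open>proots\<close> recovers the multiset of roots.\<close>

lemma prod_list_linear_factors_unique:
  fixes xs ys :: "real list"
  assumes "\<And>t. (\<Prod>l\<leftarrow>xs. t - l) = (\<Prod>l\<leftarrow>ys. t - l)"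
  shows "mset xs = mset ys"
proof -
  define p where "p zs = (\<Prod>l\<leftarrow>zs. [:- l, 1:])" for zs :: "real list"
  have poly: "poly (p zs) t = (\<Prod>l\<leftarrow>zs. t - l)" for zs t
    by (induction zs) (simp_all add: p_def algebra_simps)
  have nz: "p zs \<noteq> 0" for zs
    unfolding p_def by (subst prod_list_zero_iff) auto
  have roots: "proots (p zs) = mset zs" for zs
  proof (induction zs)
    case (Cons a zs)
    have "p (a # zs) = [:- a, 1:] * p zs" by (simp add: p_def)
    then show ?case using Cons nz[of zs] by (simp add: proots_mult del: mult_pCons_left)
  qed (simp add: p_def)
  have "poly (p xs) = poly (p ys)" using assms by (simp add: fun_eq_iff poly)
  then have "p xs = p ys" by (simp add: poly_eq_poly_eq_iff)
  then show ?thesis by (metis roots)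
qed

text \<open>The characteristic polynomial fixes the multiset of roots and the order then fixes the
  list. The reversals translate the decreasing order into the increasing one of
  \<open>sort\<close>.\<close>

lemma eigenvalue_list_eq:
  assumes "sorted_wrt (\<ge>) ls" "\<And>t. det (mat t - X) = (\<Prod>l\<leftarrow>ls. t - l)"
  shows "eigenvalue_list X = ls"
  unfolding eigenvalue_list_def
proof (rule the_equality)
  fix ms assume ms: "sorted_wrt (\<ge>) ms \<and> (\<forall>t. det (mat t - X) = (\<Prod>l\<leftarrow>ms. t - l))"
  have "mset ms = mset ls"
    by (rule prod_list_linear_factors_unique) (use ms assms in simp)
  then have "sort (rev ls) = rev ms" "sort (rev ls) = rev ls"
    using ms assms by (auto intro!: properties_for_sort simp: sorted_wrt_rev)
  then show "ms = ls" by simp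
qed (use assms in auto)

text \<open>A relational form of \<open>eigval\<close>, in which the spectrum is a free variable;
  the compactness argument for the relaxation needs this. Values of \<open>l\<close> outside 1..n
  are unconstrained.\<close>

definition has_spectrum :: "real^'n^'n \<Rightarrow> (nat \<Rightarrow> real) \<Rightarrow> bool" where
  "has_spectrum X l \<longleftrightarrow> (\<forall>i j. 1 \<le> i \<longrightarrow> i \<le> j \<longrightarrow> j \<le> CARD('n) \<longrightarrow> l j \<le> l i)
     \<and> (\<forall>t. det (mat t - X) = (\<Prod>i=1..CARD('n). t - l i))"

lemma prod_list_upt_Suc: "(\<Prod>i\<leftarrow>[1..<Suc n]. f i) = (\<Prod>i=1..n. f i)"
  by (metis atLeastLessThanSuc_atLeastAtMost prod.distinct_set_conv_list distinct_upt set_upt)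

lemma eigval_eqI:
  fixes X :: "real^'n^'n"
  assumes "has_spectrum X l" "1 \<le> i" "i \<le> CARD('n)"
  shows "eigval X i = l i"
proof -
  have "eigenvalue_list X = map l [1..<Suc (CARD('n))]"
  proof (rule eigenvalue_list_eq)
    show "sorted_wrt (\<ge>) (map l [1..<Suc (CARD('n))])"
      using assms(1) by (auto simp: has_spectrum_def sorted_wrt_iff_nth_less simp del: upt_Suc)
    show "det (mat t - X) = (\<Prod>l\<leftarrow>map l [1..<Suc (CARD('n))]. t - l)" for t
      using assms(1) prod_list_upt_Suc[of "\<lambda>i. t - l i"] by (simp add: has_spectrum_def o_def del: upt_Suc)
  qed
  then show ?thesis using assms(2,3) by (simp add: eigval_def del: upt_Suc)
qed

text \<open>The diagonal of a spectral decomposition, sorted, is a witness for the definite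
  description behind \<open>eigval\<close>.\<close>

lemma has_spectrum_eigval:
  fixes X :: "real^'n^'n"
  assumes "transpose X = X"
  shows "has_spectrum X (eigval X)"
proof -
  obtain Q d where Q: "orthogonal_matrix Q" "X = Q ** diag d ** transpose Q"
    using spectral_decomposition[OF assms] .
  obtain js :: "'n list" where js: "set js = UNIV" "distinct js"
    using finite_distinct_list[of "UNIV :: 'n set"] by auto
  define ls where "ls = rev (sort (map (\<lambda>j. d $ j) js))"
  have len: "length ls = CARD('n)" using js by (simp add: ls_def flip: distinct_card)
  define l where "l i = ls ! (i - 1)" for i
  have "has_spectrum X l"
    unfolding has_spectrum_def
  proof (intro conjI allI impI)
    have "sorted_wrt (\<ge>) ls" by (simp add: ls_def sorted_wrt_rev)
    then show "l j \<le> l i" if "1 \<le> i" "i \<le> j" "j \<le> CARD('n)" for i j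
      using that len by (cases "i = j") (auto simp: l_def sorted_wrt_iff_nth_less)
    fix t
    have "ls = map l [1..<Suc (CARD('n))]"
      by (rule nth_equalityI) (auto simp: len l_def simp del: upt_Suc)
    then have "(\<Prod>i=1..CARD('n). t - l i) = (\<Prod>x\<leftarrow>ls. t - x)"
      using prod_list_upt_Suc[of "\<lambda>i. t - l i"] by (simp add: o_def del: upt_Suc)
    also have "\<dots> = prod_mset (image_mset (\<lambda>x. t - x) (mset ls))"
      by (metis mset_map prod_mset_prod_list)
    also have "\<dots> = prod_mset (image_mset (\<lambda>j. t - d $ j) (mset js))"
      by (simp add: ls_def image_mset.compositionality o_def)
    also have "\<dots> = (\<Prod>j\<leftarrow>js. t - d $ j)"
      by (metis mset_map prod_mset_prod_list)
    also have "\<dots> = (\<Prod>j\<in>UNIV. t - d $ j)"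
      using prod.distinct_set_conv_list[OF js(2), of "\<lambda>j. t - d $ j"] js(1) by simp
    also have "\<dots> = det (mat t - X)"
      by (simp add: Q charpoly_diagonalized)
    finally show "det (mat t - X) = (\<Prod>i=1..CARD('n). t - l i)" ..
  qed
  then show ?thesis
    using eigval_eqI[OF \<open>has_spectrum X l\<close>] by (auto simp: has_spectrum_def intro!: prod.cong)
qed

lemma eigval_antimono:
  fixes X :: "real^'n^'n"
  assumes "transpose X = X" "1 \<le> i" "i \<le> j" "j \<le> CARD('n)"
  shows "eigval X j \<le> eigval X i"
  using has_spectrum_eigval[OF assms(1)] assms(2-) by (simp add: has_spectrum_def)

lemma mat_mult_vec: "mat c *v x = (c::real) *\<^sub>R x"
  by (simp add: vec_eq_iff matrix_vector_mult_def mat_def if_distrib[of "\<lambda>x. x * _"] cong: if_cong)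

lemma eigval_nonneg:
  fixes X :: "real^'n^'n"
  assumes sym: "transpose X = X" and psd: "\<And>x. x \<bullet> (X *v x) \<ge> 0" and i: "1 \<le> i" "i \<le> CARD('n)"
  shows "eigval X i \<ge> 0"
proof -
  have "det (mat (eigval X i) - X) = 0"
    using has_spectrum_eigval[OF sym] i by (auto simp: has_spectrum_def intro!: prod_zero)
  then have "\<not> invertible (mat (eigval X i) - X)" by (simp add: invertible_det_nz)
  then obtain x where x: "(mat (eigval X i) - X) *v x = 0" "x \<noteq> 0"
    using matrix_left_invertible_ker invertible_left_inverse by blast
  then have "X *v x = eigval X i *\<^sub>R x" by (simp add: matrix_vector_mult_diff_rdistrib mat_mult_vec)
  then have "eigval X i * (x \<bullet> x) \<ge> 0" using psd[of x] by simp
  moreover have "x \<bullet> x > 0" using x(2) by simp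
  ultimately show ?thesis by (simp add: zero_le_mult_iff)
qed

text \<open>In spectral coordinates the form is a sum of squares weighted by the diagonal entries.
  Each of these is a root of the characteristic polynomial, hence some
  \<open>eigval X i\<close>.\<close>

lemma inner_le_eigval_1:
  fixes X :: "real^'n^'n"
  assumes sym: "transpose X = X"
  shows "x \<bullet> (X *v x) \<le> eigval X 1 * (x \<bullet> x)"
proof -
  obtain Q d where Q: "orthogonal_matrix Q" "X = Q ** diag d ** transpose Q"
    using spectral_decomposition[OF sym] .
  let ?y = "transpose Q *v x"
  have "d $ j \<le> eigval X 1" for j
  proof -
    have "det (mat (d $ j) - X) = 0"
      unfolding Q(2) charpoly_diagonalized[OF Q(1)] by (rule prod_zero) auto
    then obtain i where "i \<in> {1..CARD('n)}" "d $ j = eigval X i"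
      using has_spectrum_eigval[OF sym] by (auto simp: has_spectrum_def prod_zero_iff)
    then show ?thesis using eigval_antimono[OF sym, of 1 i] by simp
  qed
  then have "x \<bullet> (X *v x) \<le> (\<Sum>j\<in>UNIV. eigval X 1 * (?y $ j)\<^sup>2)"
    unfolding Q(2) diagonalized_inner by (intro sum_mono mult_right_mono) (auto simp flip: Q(2))
  also have "\<dots> = eigval X 1 * (?y \<bullet> ?y)"
    by (simp add: inner_vec_def power2_eq_square sum_distrib_left)
  also have "?y \<bullet> ?y = x \<bullet> x"
    using Q(1) by (metis dot_lmul_matrix matrix_vector_mul_assoc matrix_vector_mul_lid orthogonal_matrix_def transpose_matrix_vector transpose_transpose)
  finally show ?thesis .
qed

subsection \<open>Positive definite matrices\<close>

lemma posdef_inner_pos: "posdef P \<Longrightarrow> v \<noteq> 0 \<Longrightarrow> v \<bullet> (P *v v) > 0"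
  and posdef_symmetric: "posdef P \<Longrightarrow> transpose P = P"
  by (auto simp: posdef_def)

lemma posdef_diagonalized_iff:
  assumes Q: "orthogonal_matrix Q"
  shows "posdef (Q ** diag d ** transpose Q) \<longleftrightarrow> (\<forall>i. d $ i > 0)"
proof
  assume pd: "posdef (Q ** diag d ** transpose Q)"
  show "\<forall>i. d $ i > 0"
  proof
    fix i
    \<comment> \<open>The i-th eigenvector, at which the quadratic form takes the value
      \<open>d $ i\<close>.\<close>
    let ?v = "Q *v axis i 1"
    have v: "transpose Q *v ?v = axis i 1"
      using Q by (metis matrix_vector_mul_assoc matrix_vector_mul_lid orthogonal_matrix_def)
    then have "?v \<noteq> 0"
      by (metis axis_eq_0_iff matrix_vector_mult_0_right zero_neq_one)
    then have "0 < ?v \<bullet> ((Q ** diag d ** transpose Q) *v ?v)" by (rule posdef_inner_pos[OF pd])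
    also have "\<dots> = d $ i"
      unfolding diagonalized_inner v by (simp add: axis_def if_distrib[of "\<lambda>x. _ * x"] if_distrib[of "\<lambda>x. x ^ _"] cong: if_cong)
    finally show "d $ i > 0" .
  qed
next
  assume d: "\<forall>i. d $ i > 0"
  have "transpose (diag d) = diag d" by (simp add: vec_eq_iff transpose_def diag_def)
  then have "transpose (Q ** diag d ** transpose Q) = Q ** diag d ** transpose Q"
    by (simp add: matrix_transpose_mul matrix_mul_assoc)
  moreover have "v \<bullet> ((Q ** diag d ** transpose Q) *v v) > 0" if "v \<noteq> 0" for v
  proof -
    have "transpose Q *v v \<noteq> 0"
      using Q that by (metis matrix_vector_mul_assoc matrix_vector_mul_lid matrix_vector_mult_0_right orthogonal_matrix_def)
    then obtain i where "(transpose Q *v v) $ i \<noteq> 0" by (auto simp: vec_eq_iff)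
    then show ?thesis unfolding diagonalized_inner
      using d by (intro sum_pos2[of _ i]) (auto simp: less_imp_le)
  qed
  ultimately show "posdef (Q ** diag d ** transpose Q)" by (simp add: posdef_def)
qed

lemma posdef_det_pos:
  assumes "posdef P"
  shows "det P > 0"
proof -
  obtain Q d where Q: "orthogonal_matrix Q" "P = Q ** diag d ** transpose Q"
    using spectral_decomposition[OF posdef_symmetric[OF assms]] .
  have "det Q * det Q = det (Q ** transpose Q)" by (simp add: det_mul)
  also have "\<dots> = 1" using Q by (simp add: orthogonal_matrix_def)
  finally have "det P = (\<Prod>i\<in>UNIV. d $ i)"
    by (simp add: Q det_mul det_diag mult_ac)
  then show ?thesis using assms posdef_diagonalized_iff[OF Q(1), of d] Q(2) by (simp add: prod_pos)
qed

text \<open>Let \<open>v\<close> be an eigenvector of R - S with eigenvalue d. Then 0 = |R v|^2 - |S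
  v|^2 = (R v - S v) . (R v + S v) = d (v . R v + v . S v), and the last bracket is positive. So
  every eigenvalue of the symmetric matrix R - S is zero.\<close>

lemma posdef_sqrt_unique:
  assumes R: "posdef R" "posdef S" "R ** R = S ** S"
  shows "R = S"
proof -
  have "transpose (R - S) = R - S"
    using R(1,2)[THEN posdef_symmetric] by (simp add: vec_eq_iff transpose_def)
  then obtain Q d where Q: "orthogonal_matrix Q" "R - S = Q ** diag d ** transpose Q"
    using spectral_decomposition by blast
  have "d $ i = 0" for i
  proof -
    define v where "v = Q *v axis i 1"
    have v: "transpose Q *v v = axis i 1"
      unfolding v_def using Q by (metis matrix_vector_mul_assoc matrix_vector_mul_lid orthogonal_matrix_def)
    then have "v \<noteq> 0"
      by (metis axis_eq_0_iff matrix_vector_mult_0_right zero_neq_one)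
    have "(R - S) *v v = Q *v (diag d *v axis i 1)"
      unfolding Q(2) by (simp add: v del: transpose_matrix_vector flip: matrix_vector_mul_assoc)
    also have "diag d *v axis i 1 = d $ i *\<^sub>R axis i 1"
      by (auto simp: diag_vec vec_eq_iff axis_def)
    finally have E: "R *v v - S *v v = d $ i *\<^sub>R v"
      by (simp add: matrix_vector_mult_diff_rdistrib matrix_vector_mult_scaleR v_def)
    have sq: "(T *v v) \<bullet> (T *v v) = v \<bullet> ((T ** T) *v v)" if "posdef T" for T
      using symmetric_inner[OF posdef_symmetric[OF that], of v "T *v v"]
      by (simp add: matrix_vector_mul_assoc)
    have "0 = (R *v v) \<bullet> (R *v v) - (S *v v) \<bullet> (S *v v)"
      using R by (simp add: sq)
    also have "\<dots> = (R *v v - S *v v) \<bullet> (R *v v + S *v v)"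
      by (simp add: inner_diff_left inner_add_right inner_commute[of "S *v v" "R *v v"])
    also have "\<dots> = d $ i * (v \<bullet> (R *v v) + v \<bullet> (S *v v))"
      by (simp add: E inner_add_right distrib_left)
    finally show ?thesis
      using posdef_inner_pos[OF R(1) \<open>v \<noteq> 0\<close>] posdef_inner_pos[OF R(2) \<open>v \<noteq> 0\<close>] by auto
  qed
  then have "diag d = 0" by (simp add: vec_eq_iff diag_def)
  then have "R - S = 0" unfolding Q(2) by (simp add: vec_eq_iff matrix_matrix_mult_def)
  then show ?thesis by simp
qed

lemma posdef_sqrt:
  fixes C :: "real^'n^'n"
  assumes "posdef C"
  shows "posdef (posdef_sqrt C)" "posdef_sqrt C ** posdef_sqrt C = C"
proof -
  obtain Q d where Q: "orthogonal_matrix Q" "C = Q ** diag d ** transpose Q"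
    using spectral_decomposition[OF posdef_symmetric[OF assms]] .
  have d: "\<forall>i. d $ i > 0" using assms posdef_diagonalized_iff[OF Q(1), of d] Q(2) by simp
  define R where "R = Q ** diag (\<chi> i. sqrt (d $ i)) ** transpose Q"
  have R: "posdef R" unfolding R_def using d by (simp add: posdef_diagonalized_iff[OF Q(1)])
  have dd: "diag (\<chi> i. sqrt (d $ i)) ** diag (\<chi> i. sqrt (d $ i)) = diag d"
    using d by (auto simp: vec_eq_iff matrix_matrix_mult_def diag_def less_imp_le
        if_distrib[of "\<lambda>x. x * _"] if_distrib[of "\<lambda>x. _ * x"] cong: if_cong)
  have "R ** R = Q ** diag (\<chi> i. sqrt (d $ i)) ** (transpose Q ** Q) ** diag (\<chi> i. sqrt (d $ i)) ** transpose Q"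
    by (simp add: R_def matrix_mul_assoc)
  also have "\<dots> = Q ** (diag (\<chi> i. sqrt (d $ i)) ** diag (\<chi> i. sqrt (d $ i))) ** transpose Q"
    using Q(1) by (simp add: orthogonal_matrix_def matrix_mul_assoc)
  finally have "R ** R = C" by (simp only: dd Q(2))
  have "posdef_sqrt C = R"
    unfolding posdef_sqrt_def
  proof (rule the_equality)
    show "posdef R \<and> R ** R = C" using R \<open>R ** R = C\<close> by simp
    show "S = R" if "posdef S \<and> S ** S = C" for S
      using posdef_sqrt_unique[of S R] that R \<open>R ** R = C\<close> by simp
  qed
  then show "posdef (posdef_sqrt C)" "posdef_sqrt C ** posdef_sqrt C = C"
    using R \<open>R ** R = C\<close> by auto
qed

subsection \<open>Elementary symmetric functions\<close>

definition esym :: "nat \<Rightarrow> 'a set \<Rightarrow> ('a \<Rightarrow> real) \<Rightarrow> real" where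
  "esym m I y = (\<Sum>T | T \<subseteq> I \<and> card T = m. \<Prod>i\<in>T. y i)"

lemma esym_0 [simp]: "finite I \<Longrightarrow> esym 0 I y = 1"
proof -
  assume "finite I"
  then have "{T. T \<subseteq> I \<and> card T = 0} = {{}}" by (auto dest: finite_subset)
  then show ?thesis by (simp add: esym_def)
qed

lemma esym_empty_Suc [simp]: "esym (Suc m) {} y = 0"
  by (auto simp: esym_def intro!: sum.neutral)

text \<open>Subsets are split according to whether they contain \<open>k\<close>; this recursion
  drives the inductions below.\<close>

lemma esym_insert:
  assumes "finite I" "k \<notin> I"
  shows "esym (Suc m) (insert k I) y = esym (Suc m) I y + y k * esym m I y"
proof -
  let ?S = "\<lambda>m. {T. T \<subseteq> I \<and> card T = m}"
  have fin: "finite T" if "T \<subseteq> I" for T using that assms(1) by (rule finite_subset)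
  have "{T. T \<subseteq> insert k I \<and> card T = Suc m} = ?S (Suc m) \<union> insert k ` ?S m" (is "?L = ?R")
  proof
    show "?L \<subseteq> ?R"
    proof
      fix T assume T: "T \<in> ?L"
      show "T \<in> ?R"
      proof (cases "k \<in> T")
        case True
        then have "T = insert k (T - {k})" "T - {k} \<subseteq> I" "card (T - {k}) = m"
          using T finite_subset[of T "insert k I"] assms(1) by auto
        then show ?thesis by blast
      qed (use T in blast)
    qed
    show "?R \<subseteq> ?L" using fin assms(2) by (auto simp: card_insert_if)
  qed
  moreover have "?S (Suc m) \<inter> insert k ` ?S m = {}" using assms(2) by blast
  moreover have "inj_on (insert k) (?S m)" using assms(2) by (intro inj_onI) (auto 4 3)
  ultimately have "esym (Suc m) (insert k I) y = esym (Suc m) I y + (\<Sum>T\<in>?S m. \<Prod>i\<in>insert k T. y i)"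
    unfolding esym_def using assms(1) by (simp add: sum.union_disjoint sum.reindex)
  also have "(\<Sum>T\<in>?S m. \<Prod>i\<in>insert k T. y i) = (\<Sum>T\<in>?S m. y k * (\<Prod>i\<in>T. y i))"
    using assms fin by (intro sum.cong refl) (subst prod.insert, auto)
  finally show ?thesis by (simp add: esym_def sum_distrib_left)
qed

lemma esym_nonneg: "(\<And>i. i \<in> I \<Longrightarrow> 0 \<le> y i) \<Longrightarrow> 0 \<le> esym m I y"
  unfolding esym_def by (intro sum_nonneg prod_nonneg) auto

lemma esym_scale: "esym m I (\<lambda>i. c * y i) = c ^ m * esym m I y"
  by (auto simp: esym_def prod.distrib sum_distrib_left intro!: sum.cong)

lemma esym_ge_sum:
  assumes "finite I" "\<And>i. i \<in> I \<Longrightarrow> 0 \<le> y i \<and> y i \<le> 1"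
  shows "(\<Sum>i\<in>I. y i) - real m \<le> esym (Suc m) I y"
  using assms
proof (induction I arbitrary: m rule: finite_induct)
  case (insert k I)
  have y: "0 \<le> y k" "y k \<le> 1" using insert.prems by auto
  have nn: "0 \<le> esym j I y" for j using insert.prems by (auto intro!: esym_nonneg)
  have IH: "(\<Sum>i\<in>I. y i) - real j \<le> esym (Suc j) I y" for j using insert.IH insert.prems by blast
  show ?case
  proof (cases m)
    case 0
    then show ?thesis using IH[of 0] insert.hyps by (simp add: esym_insert)
  next
    case (Suc p)
    \<comment> \<open>The lower bound for \<open>esym (Suc p) I y\<close> from the induction
      hypothesis. If it is at least 1, the product with \<open>y k\<close> contributes at least
      \<open>y k\<close>; otherwise (1 - a) (1 - y k) \<ge> 0 says that already
      \<open>y k * a\<close> is large enough.\<close>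
    define a where "a = (\<Sum>i\<in>I. y i) - real p"
    have "a - 1 + y k \<le> esym (Suc (Suc p)) I y + y k * esym (Suc p) I y"
    proof (cases "a \<ge> 1")
      case True
      then have "y k * 1 \<le> y k * esym (Suc p) I y"
        using y IH[of p] by (intro mult_left_mono) (auto simp: a_def)
      then show ?thesis using IH[of "Suc p"] by (simp add: a_def)
    next
      case False
      have "y k * a \<le> y k * esym (Suc p) I y"
        using y IH[of p] by (intro mult_left_mono) (auto simp: a_def)
      moreover have "0 \<le> (1 - a) * (1 - y k)" using False y by simp
      ultimately show ?thesis using nn[of "Suc (Suc p)"] by (simp add: algebra_simps)
    qed
    then show ?thesis using insert.hyps Suc by (simp add: esym_insert a_def)
  qed
qed simp

text \<open>By homogeneity: dividing by \<open>t\<close> puts the entries into the unit cube with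
  sum \<open>m\<close>, where \<open>esym_ge_sum\<close> gives the value at least 1.\<close>

lemma esym_ge_power:
  assumes I: "finite I" "\<And>i. i \<in> I \<Longrightarrow> 0 \<le> y i \<and> y i \<le> t"
    and m: "m > 0" and sum: "(\<Sum>i\<in>I. y i) = real m * t" and t: "0 \<le> t"
  shows "t ^ m \<le> esym m I y"
proof (cases "t = 0")
  case True
  then show ?thesis using I m by (auto intro!: esym_nonneg simp: power_0_left)
next
  case False
  then have "t > 0" using t by simp
  obtain p where p: "m = Suc p" using m by (cases m) auto
  have "(\<Sum>i\<in>I. 1 / t * y i) - real p \<le> esym m I (\<lambda>i. 1 / t * y i)"
    unfolding p using I \<open>t > 0\<close> by (intro esym_ge_sum) (auto simp: divide_le_eq)
  moreover have "(\<Sum>i\<in>I. 1 / t * y i) = real m"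
    using sum \<open>t > 0\<close> by (simp flip: sum_divide_distrib)
  ultimately have "1 \<le> (1 / t) ^ m * esym m I y" unfolding esym_scale by (simp add: p)
  then show ?thesis using \<open>t > 0\<close> by (simp add: power_one_over field_simps)
qed

text \<open>The power function lies above its tangent at \<open>a\<close>. The point of evaluation
  is the mean of \<open>N\<close> entries of mean \<open>a\<close> together with one further entry
  \<open>b\<close>.\<close>

lemma weighted_bernoulli:
  fixes a b :: real
  assumes "0 \<le> a" "0 \<le> b"
  shows "a ^ Suc m + real (Suc m) / (real N + 1) * (b - a) * a ^ m \<le> ((real N * a + b) / (real N + 1)) ^ Suc m"
proof (cases "a = 0")
  case True
  then show ?thesis using assms by (cases m) auto
next
  case False
  then have a: "a > 0" using assms by simp
  \<comment> \<open>The relative change of the mean, so that a (1 + u) is the new mean; it is at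
    least -1 because that mean is nonnegative.\<close>
  define u where "u = (b - a) / ((real N + 1) * a)"
  have "0 \<le> real N * a" using assms by simp
  moreover have "- (real N + 1) * a = - (real N * a) - a" by (simp add: algebra_simps)
  ultimately have "- (real N + 1) * a \<le> b - a" using assms by linarith
  then have "-1 \<le> u" unfolding u_def using a by (subst pos_le_divide_eq) (auto simp: algebra_simps intro!: add_pos_nonneg)
  then have "1 + real (Suc m) * u \<le> (1 + u) ^ Suc m" by (rule Bernoulli_inequality)
  then have "a ^ Suc m * (1 + real (Suc m) * u) \<le> a ^ Suc m * (1 + u) ^ Suc m"
    using a by (intro mult_left_mono) auto
  also have "\<dots> = (a * (1 + u)) ^ Suc m" by (simp only: power_mult_distrib)
  also have "a * (1 + u) = a + (b - a) / (real N + 1)"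
    using a by (simp add: u_def distrib_left)
  also have "\<dots> = (real N * a + b) / (real N + 1)"
    by (simp add: add_divide_eq_if_simps field_simps)
  also have "a ^ Suc m * (1 + real (Suc m) * u) = a ^ Suc m + real (Suc m) / (real N + 1) * (b - a) * a ^ m"
    using a by (simp add: u_def distrib_left)
  finally show ?thesis .
qed

lemma esym_maclaurin:
  assumes "finite I" "\<And>i. i \<in> I \<Longrightarrow> 0 \<le> y i"
  shows "esym m I y \<le> real (card I choose m) * ((\<Sum>i\<in>I. y i) / real (card I)) ^ m"
  using assms
proof (induction I arbitrary: m rule: finite_induct)
  case empty
  then show ?case by (cases m) auto
next
  case (insert k I)
  define N a where "N = card I" and "a = (\<Sum>i\<in>I. y i) / real N"
  show ?case
  proof (cases m)
    case 0
    then show ?thesis using insert.hyps by simp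
  next
    case (Suc p)
    \<comment> \<open>Both binomial coefficients of the recursion are fractions of \<open>c\<close>,
      namely c q and c (1 - q). The bound then becomes \<open>c\<close> times the tangent expression
      of \<open>weighted_bernoulli\<close>.\<close>
    define c q where "c = real (Suc N choose Suc p)" and "q = real (Suc p) / (real N + 1)"
    have a: "0 \<le> a" "0 \<le> y k" using insert.prems by (auto simp: a_def intro!: divide_nonneg_nonneg sum_nonneg)
    \<comment> \<open>True for empty \<open>I\<close> as well, both sides being zero.\<close>
    have Na: "real N * a = (\<Sum>i\<in>I. y i)"
      using insert.hyps by (cases "I = {}") (auto simp: a_def N_def)
    have "(real N + 1) * real (N choose p) = c * real (Suc p)"
      unfolding c_def using Suc_times_binomial_eq[of N p] by (metis of_nat_Suc of_nat_mult add.commute)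
    then have c1: "real (N choose p) = c * q" by (simp add: q_def field_simps)
    have c2: "real (N choose Suc p) = c - c * q" unfolding c1[symmetric] by (simp add: c_def)
    have IH: "esym j I y \<le> real (N choose j) * a ^ j" for j
      using insert.IH[of j] insert.prems by (simp add: N_def a_def)
    have "esym m (insert k I) y = esym (Suc p) I y + y k * esym p I y"
      using insert.hyps Suc by (simp add: esym_insert)
    also have "\<dots> \<le> real (N choose Suc p) * a ^ Suc p + y k * (real (N choose p) * a ^ p)"
      using a by (intro add_mono mult_left_mono IH)
    also have "\<dots> = c * (a ^ Suc p + q * (y k - a) * a ^ p)"
      unfolding c1 c2 by (simp add: algebra_simps)
    also have "\<dots> \<le> c * ((real N * a + y k) / (real N + 1)) ^ Suc p"
      unfolding q_def by (intro mult_left_mono weighted_bernoulli a) (simp add: c_def)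
    finally show ?thesis
      using insert.hyps Suc by (simp add: Na[unfolded N_def] N_def c_def add.commute)
  qed
qed

section \<open>The split index and its value for a sorted sequence\<close>

definition sorted_nonneg :: "nat \<Rightarrow> (nat \<Rightarrow> real) \<Rightarrow> bool" where
  "sorted_nonneg n l \<longleftrightarrow> (\<forall>i j. 1 \<le> i \<longrightarrow> i \<le> j \<longrightarrow> j \<le> n \<longrightarrow> l j \<le> l i)
     \<and> (\<forall>i. 1 \<le> i \<longrightarrow> i \<le> n \<longrightarrow> 0 \<le> l i)"

context
  fixes n r :: nat and l :: "nat \<Rightarrow> real"
begin

text \<open>\<open>tavg\<close>, \<open>strict_split\<close> and \<open>split_value\<close> repeat
  \<open>tail_avg\<close>, the condition in \<open>split_index\<close> and the value in
  \<open>f_fun\<close> for a bare sequence \<open>l\<close>, so that splitting can be studied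
  without matrices.\<close>

definition tavg :: "nat \<Rightarrow> real" where
  "tavg k = 1 / real (r - k) * (\<Sum>i = k+1..n. l i)"

definition strict_split :: "nat \<Rightarrow> bool" where
  "strict_split k \<longleftrightarrow> k < r \<and> (k = 0 \<or> l k > tavg k) \<and> tavg k \<ge> l (k+1)"

text \<open>The weak inequality makes the condition closed in \<open>l\<close>; uniqueness of the index is lost, but not
  that of the value.\<close>

definition weak_split :: "nat \<Rightarrow> bool" where
  "weak_split k \<longleftrightarrow> k < r \<and> (k = 0 \<or> l k \<ge> tavg k) \<and> tavg k \<ge> l (k+1)"

definition split_value :: "nat \<Rightarrow> real" where
  "split_value k = (\<Prod>i = 1..k. l i) * tavg k ^ (r - k)"

lemma strict_imp_weak_split: "strict_split k \<Longrightarrow> weak_split k"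
  by (auto simp: strict_split_def weak_split_def)

context
  assumes sorted: "sorted_nonneg n l" and r: "0 < r" "r \<le> n"
begin

private lemma dec: "1 \<le> i \<Longrightarrow> i \<le> j \<Longrightarrow> j \<le> n \<Longrightarrow> l j \<le> l i"
  and nonneg: "1 \<le> i \<Longrightarrow> i \<le> n \<Longrightarrow> 0 \<le> l i"
  using sorted by (auto simp: sorted_nonneg_def)

lemma tavg_sum: "k < r \<Longrightarrow> real (r - k) * tavg k = (\<Sum>i = k+1..n. l i)"
  by (simp add: tavg_def)

text \<open>\<open>tavg k\<close> is a weighted mean of \<open>l (Suc k)\<close> and
  \<open>tavg (Suc k)\<close>, with weights 1 and r - k - 1. Comparisons between neighbouring
  indices all come from this.\<close>

lemma tavg_Suc:
  assumes "Suc k < r"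
  shows "real (r - k) * tavg k = l (Suc k) + (real (r - k) - 1) * tavg (Suc k)"
proof -
  have S: "(\<Sum>i = k+1..n. l i) = l (Suc k) + (\<Sum>i = Suc k+1..n. l i)"
    using assms r by (simp add: sum.atLeast_Suc_atMost)
  have e: "real (r - Suc k) = real (r - k) - 1" using assms by (simp add: of_nat_diff)
  have 1: "real (r - k) * tavg k = (\<Sum>i = k+1..n. l i)"
    by (rule tavg_sum) (use assms in simp)
  have 2: "real (r - Suc k) * tavg (Suc k) = (\<Sum>i = Suc k+1..n. l i)"
    by (rule tavg_sum) (rule assms)
  show ?thesis by (simp only: 1 S 2[unfolded e])
qed

lemma tavg_less_step:
  assumes "Suc k < r" "tavg (Suc k) < l (Suc k)"
  shows "tavg k < l (Suc k)"
proof -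
  have "real (r - k) > 1" using assms(1) by (simp add: of_nat_diff)
  then have "(real (r - k) - 1) * tavg (Suc k) < (real (r - k) - 1) * l (Suc k)"
    using assms by simp
  then have "real (r - k) * tavg k < real (r - k) * l (Suc k)"
    unfolding tavg_Suc[OF assms(1)] by (simp add: algebra_simps)
  then show ?thesis using \<open>real (r - k) > 1\<close> by (simp add: mult_less_cancel_left)
qed

text \<open>Descending from \<open>k\<close>, where \<open>tavg k < l k\<close>: monotonicity of
  \<open>l\<close> and the weighted mean carry the inequality from each index to the one below. It
  contradicts the second half of the split condition there, which gives uniqueness.\<close>

lemma strict_split_below:
  assumes "strict_split k" "j < k"
  shows "tavg j < l (Suc j)"
  using assms(2)
proof (induction "k - j" arbitrary: j)
  case (Suc d)
  have k: "k < r" "tavg k < l k" using assms(1) Suc.prems by (auto simp: strict_split_def)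
  have "tavg (Suc j) < l (Suc j)"
  proof (cases "Suc j = k")
    case False
    then have "tavg (Suc j) < l (Suc (Suc j))" using Suc by simp
    also have "\<dots> \<le> l (Suc j)" using False Suc.prems k r by (intro dec) auto
    finally show ?thesis .
  qed (use k in simp)
  then show ?case using Suc.prems k by (intro tavg_less_step) auto
qed simp

lemma strict_split_unique:
  assumes "strict_split j" "strict_split k"
  shows "j = k"
proof (cases j k rule: linorder_cases)
  case less
  then show ?thesis using strict_split_below[OF assms(2) less] assms(1) by (simp add: strict_split_def)
next
  case greater
  then show ?thesis using strict_split_below[OF assms(1) greater] assms(2) by (simp add: strict_split_def)
qed

lemma strict_split_exists: "\<exists>k. strict_split k"
proof -
  \<comment> \<open>The least index satisfying the second half of the condition is the split.
    Minimality gives \<open>l k\<close> above the preceding average, and the weighted mean turns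
    this into the first half.\<close>
  define P where "P k \<longleftrightarrow> k < r \<and> l (Suc k) \<le> tavg k" for k
  have "l r \<le> (\<Sum>i = r..n. l i)"
    using r nonneg by (intro member_le_sum) auto
  then have "P (r - 1)" using r by (simp add: P_def tavg_def)
  define k where "k = (LEAST k. P k)"
  have k: "P k" unfolding k_def using \<open>P (r - 1)\<close> by (rule LeastI)
  have "tavg k < l k" if "k > 0"
  proof -
    obtain j where j: "k = Suc j" using \<open>k > 0\<close> gr0_implies_Suc by blast
    have "\<not> P j" using not_less_Least[of j P] j unfolding k_def by simp
    then have "tavg j < l k" using k by (auto simp: P_def j)
    have "real (r - j) > 1" using k by (simp add: P_def j of_nat_diff)
    then have "real (r - j) * tavg j < real (r - j) * l k"
      using \<open>tavg j < l k\<close> by (intro mult_strict_left_mono) auto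
    then have "(real (r - j) - 1) * tavg k < (real (r - j) - 1) * l k"
      using tavg_Suc[of j] k by (simp add: P_def j algebra_simps)
    then show ?thesis using \<open>real (r - j) > 1\<close> by (simp add: mult_less_cancel_left)
  qed
  then show ?thesis using k by (auto simp: strict_split_def P_def)
qed

text \<open>A weak split that is not strict has a tie \<open>l k = tavg k\<close>. Then the average
  at the preceding index is the same, so the index can be lowered by one without changing the value;
  this ends at the strict split.\<close>

lemma split_value_weak:
  assumes "strict_split k0" "weak_split k"
  shows "split_value k = split_value k0"
  using assms(2)
proof (induction k)
  case 0
  then have "\<not> 0 < k0" using strict_split_below[OF assms(1), of 0] by (auto simp: weak_split_def)
  then show ?case by simp
next
  case (Suc k)
  show ?case
  proof (cases "tavg (Suc k) < l (Suc k)")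
    case True
    then have "strict_split (Suc k)" using Suc.prems by (auto simp: strict_split_def weak_split_def)
    then show ?thesis using strict_split_unique assms(1) by blast
  next
    case False
    then have e: "l (Suc k) = tavg (Suc k)" and kr: "Suc k < r" using Suc.prems by (auto simp: weak_split_def)
    have "real (r - k) * tavg k = real (r - k) * tavg (Suc k)"
      unfolding tavg_Suc[OF kr] e by (simp add: algebra_simps)
    then have t: "tavg k = tavg (Suc k)" using kr by simp
    have "weak_split k" unfolding weak_split_def t using kr r e dec[of k "Suc k"] by (auto simp: Suc_le_eq)
    moreover have "split_value (Suc k) = split_value k"
      using kr by (simp add: split_value_def t e flip: power_Suc) (simp add: Suc_diff_Suc flip: power_Suc)
    ultimately show ?thesis using Suc.IH by simp
  qed
qed

lemma tavg_nonneg: "k < r \<Longrightarrow> 0 \<le> tavg k"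
  using nonneg by (auto simp: tavg_def intro!: divide_nonneg_nonneg sum_nonneg)

text \<open>The tail entries are at most \<open>tavg k\<close> and sum to r - k times it, so
  \<open>esym_ge_power\<close> bounds the power by a symmetric function of the tail. Multiplied by
  the first \<open>k\<close> entries, this is the part of the full sum over the sets that contain
  {1..k}.\<close>

lemma split_value_le_esym:
  assumes "weak_split k"
  shows "split_value k \<le> esym r {1..n} l"
proof -
  have k: "k < r" "l (k+1) \<le> tavg k" using assms by (auto simp: weak_split_def)
  let ?S = "{T. T \<subseteq> {k+1..n} \<and> card T = r - k}"
  have fin: "finite T" if "T \<subseteq> {k+1..n}" for T using that finite_subset by blast
  have disj: "{1..k} \<inter> T = {}" if "T \<subseteq> {k+1..n}" for T using that by fastforce
  have card: "card ({1..k} \<union> T) = k + card T" if "T \<subseteq> {k+1..n}" for T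
    using disj[OF that] fin[OF that] by (subst card_Un_disjoint) auto
  have "tavg k ^ (r - k) \<le> esym (r - k) {k+1..n} l"
  proof (rule esym_ge_power)
    show "0 \<le> l i \<and> l i \<le> tavg k" if "i \<in> {k+1..n}" for i
      using that nonneg[of i] dec[of "k+1" i] k by auto
  qed (use k tavg_sum tavg_nonneg in auto)
  then have "split_value k \<le> (\<Prod>i = 1..k. l i) * esym (r - k) {k+1..n} l"
    unfolding split_value_def using k r by (intro mult_left_mono prod_nonneg) (auto intro!: nonneg)
  also have "\<dots> = (\<Sum>T\<in>?S. \<Prod>i\<in>{1..k} \<union> T. l i)"
    unfolding esym_def sum_distrib_left
    by (intro sum.cong refl, subst prod.union_disjoint) (use fin disj in auto)
  also have "\<dots> = (\<Sum>T\<in>(\<lambda>T. {1..k} \<union> T) ` ?S. \<Prod>i\<in>T. l i)"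
  proof (subst sum.reindex)
    show "inj_on (\<lambda>T. {1..k} \<union> T) ?S"
    proof (rule inj_onI)
      fix T U assume "T \<in> ?S" "U \<in> ?S" "{1..k} \<union> T = {1..k} \<union> U"
      then show "T = U" using disj[of T] disj[of U] by blast
    qed
  qed simp
  also have "\<dots> \<le> esym r {1..n} l"
    unfolding esym_def
  proof (rule sum_mono2)
    show "(\<lambda>T. {1..k} \<union> T) ` ?S \<subseteq> {T. T \<subseteq> {1..n} \<and> card T = r}"
      using k r card by auto
    show "0 \<le> (\<Prod>i\<in>T. l i)" if "T \<in> {T. T \<subseteq> {1..n} \<and> card T = r} - (\<lambda>T. {1..k} \<union> T) ` ?S" for T
      using that by (intro prod_nonneg) (auto intro!: nonneg)
  qed simp
  finally show ?thesis .
qed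

lemma card_eq_upto_or_above:
  assumes "T \<subseteq> {1..n}" "card T = r" "T \<noteq> {1..r}"
  obtains i where "i \<in> T" "r < i" "i \<le> n"
proof -
  have "\<not> T \<subseteq> {1..r}" using assms card_subset_eq[of "{1..r}" T] by auto
  then show ?thesis using that assms(1) by fastforce
qed

lemma split_value_low_rank:
  assumes "strict_split k" "\<And>i. r < i \<Longrightarrow> i \<le> n \<Longrightarrow> l i = 0"
  shows "split_value k = esym r {1..n} l"
proof -
  have "(\<Sum>i = r..n. l i) = (\<Sum>i\<in>{r}. l i)"
    using r assms(2) by (intro sum.mono_neutral_right) auto
  then have t: "tavg (r - 1) = l r" using r by (simp add: tavg_def)
  \<comment> \<open>Only weak in general, since the entries at r - 1 and r may coincide. At this
    index the value is the product of the first \<open>r\<close> entries, the one term of the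
    symmetric function without a zero factor.\<close>
  then have "weak_split (r - 1)" 
    unfolding weak_split_def using r dec[of "r - 1" r] by (cases "r = 1") auto
  then have "split_value k = split_value (r - 1)" using split_value_weak assms(1) by metis
  also have "\<dots> = (\<Prod>i=1..r. l i)"
    unfolding split_value_def t using r by (cases r) auto
  also have "\<dots> = (\<Sum>T\<in>{{1..r}}. \<Prod>i\<in>T. l i)" by simp
  also have "\<dots> = esym r {1..n} l"
    unfolding esym_def
  proof (rule sum.mono_neutral_left)
    show "\<forall>T\<in>{T. T \<subseteq> {1..n} \<and> card T = r} - {{1..r}}. (\<Prod>i\<in>T. l i) = 0"
    proof
      fix T assume T: "T \<in> {T. T \<subseteq> {1..n} \<and> card T = r} - {{1..r}}"
      then obtain i where "i \<in> T" "r < i" "i \<le> n" using card_eq_upto_or_above by blast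
      moreover have "finite T" using T finite_subset by blast
      ultimately show "(\<Prod>i\<in>T. l i) = 0" using assms(2) by (intro prod_zero) auto
    qed
  qed (use r in auto)
  finally show ?thesis .
qed

text \<open>Every \<open>r\<close>-subset of {1..n} has an element at or above \<open>r\<close>, so
  \<open>l r = 0\<close> would annihilate all terms.\<close>

lemma esym_pos_imp: 
  assumes "esym r {1..n} l > 0"
  shows "l r > 0"
proof (rule ccontr)
  assume "\<not> l r > 0"
  then have "l r = 0" using nonneg[of r] r by simp
  then have z: "l i = 0" if "r \<le> i" "i \<le> n" for i using dec[of r i] nonneg[of i] r that by simp
  have "esym r {1..n} l = 0"
    unfolding esym_def
  proof (rule sum.neutral, rule ballI)
    fix T assume T: "T \<in> {T. T \<subseteq> {1..n} \<and> card T = r}"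
    have "\<exists>i\<in>T. l i = 0"
    proof (cases "T = {1..r}")
      case True
      then show ?thesis using r z[of r] by auto
    next
      case False
      then show ?thesis using T card_eq_upto_or_above z by (metis (mono_tags, lifting) less_imp_le mem_Collect_eq)
    qed
    moreover have "finite T" using T finite_subset by blast
    ultimately show "(\<Prod>i\<in>T. l i) = 0" by (auto intro: prod_zero)
  qed
  then show False using assms by simp
qed

lemma split_value_pos:
  assumes "l r > 0" "k < r"
  shows "split_value k > 0"
proof -
  have "l i > 0" if "1 \<le> i" "i \<le> k" for i using dec[of i r] that assms r by simp
  moreover have "l r \<le> (\<Sum>i = k+1..n. l i)"
    using r assms nonneg by (intro member_le_sum) auto
  ultimately show ?thesis
    using assms by (auto simp: split_value_def tavg_def intro!: mult_pos_pos prod_pos zero_less_power divide_pos_pos)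
qed

end
end

subsection \<open>Weighted Gram matrices\<close>

lemma matrix_add_rdistrib: "((A :: real^'n^'m) + B) ** C = A ** C + B ** C"
  by (simp add: vec_eq_iff matrix_matrix_mult_def algebra_simps sum.distrib)

text \<open>The principal minor on \<open>S\<close>: replacing the other rows by identity rows keeps
  the size of the matrix and hence its type.\<close>

definition minor :: "real^'n^'n \<Rightarrow> 'n set \<Rightarrow> real" where
  "minor G S = det (\<chi> i. if i \<in> S then G $ i else axis i 1)"

lemma sum_outer_prod_columns:
  "(\<Sum>i\<in>UNIV. x $ i *\<^sub>R outer_prod (column i V)) = V ** diag x ** transpose V"
proof -
  have "(V ** diag x) $ i $ j = V $ i $ j * x $ j" for i j
    by (simp add: matrix_matrix_mult_def diag_def if_distrib[of "\<lambda>x. _ * x"] cong: if_cong)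
  then show ?thesis
    by (simp add: vec_eq_iff matrix_matrix_mult_def[of "V ** diag x"] column_def transpose_def mult_ac)
qed

lemma sum_outer_prod_subset:
  "(\<Sum>i\<in>S. outer_prod (column i V)) = V ** diag (\<chi> i. if i \<in> S then 1 else 0) ** transpose V"
proof -
  have "(\<Sum>i\<in>S. outer_prod (column i V))
      = (\<Sum>i\<in>UNIV. (\<chi> i. if i \<in> S then 1 else 0) $ i *\<^sub>R outer_prod (column i V))"
    by (simp add: if_distrib[of "\<lambda>c. c *\<^sub>R _"] sum.If_cases cong: if_cong)
  then show ?thesis unfolding sum_outer_prod_columns .
qed

lemma det_diag_times_minor:
  fixes G :: "real^'n^'n"
  shows "det (mat u - diag x ** G)
    = (\<Sum>T\<in>UNIV. u ^ (CARD('n) - card T) * ((- 1) ^ card T * (\<Prod>i\<in>T. x $ i) * minor G T))"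
proof -
  have "mat u - diag x ** G = (\<chi> i. u *s axis i 1 + (- x $ i) *s G $ i)"
    by (auto simp: vec_eq_iff mat_def axis_def diag_def matrix_matrix_mult_def
        if_distrib[of "\<lambda>x. x * _"] cong: if_cong)
  then have "det (mat u - diag x ** G)
      = (\<Sum>T\<in>UNIV. det (\<chi> i. if i \<in> T then (- x $ i) *s G $ i else u *s axis i 1))"
    by (simp only: det_row_plus_expand)
  also have "\<dots> = (\<Sum>T\<in>UNIV. u ^ (CARD('n) - card T) * ((- 1) ^ card T * (\<Prod>i\<in>T. x $ i) * minor G T))"
  proof (rule sum.cong)
    fix T :: "'n set"
    have "det (\<chi> i. if i \<in> T then (- x $ i) *s G $ i else u *s axis i 1)
        = det (\<chi> i. (if i \<in> T then - x $ i else u) *s (if i \<in> T then G $ i else axis i 1))"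
      by (rule arg_cong[where f = det]) (auto simp: vec_eq_iff)
    also have "\<dots> = (\<Prod>i\<in>UNIV. if i \<in> T then - x $ i else u) * minor G T"
      unfolding minor_def by (rule det_rows_mul)
    also have "(\<Prod>i\<in>UNIV. if i \<in> T then - x $ i else u) = (\<Prod>i\<in>T. - x $ i) * u ^ card (- T)"
      by (simp add: prod.If_cases)
    also have "(\<Prod>i\<in>T. - x $ i) = (- 1) ^ card T * (\<Prod>i\<in>T. x $ i)"
      by (simp add: prod_uminus)
    finally show "det (\<chi> i. if i \<in> T then (- x $ i) *s G $ i else u *s axis i 1)
        = u ^ (CARD('n) - card T) * ((- 1) ^ card T * (\<Prod>i\<in>T. x $ i) * minor G T)"
      by (simp add: Compl_eq_Diff_UNIV card_Diff_subset mult_ac)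
  qed simp
  finally show ?thesis .
qed

text \<open>A similarity by \<open>V\<close>, written without an inverse: multiplying the first
  matrix by \<open>V\<close> on the right equals multiplying the second by \<open>V\<close> on the
  left.\<close>

lemma charpoly_commute:
  fixes V :: "real^'n^'n"
  assumes "det V \<noteq> 0"
  shows "det (mat u - V ** D ** transpose V) = det (mat u - D ** (transpose V ** V))"
proof -
  have "V ** mat u = mat u ** V"
    by (simp add: vec_eq_iff matrix_matrix_mult_def mat_def if_distrib[of "\<lambda>x. _ * x"] if_distrib[of "\<lambda>x. x * _"] mult.commute cong: if_cong)
  then have "(mat u - V ** D ** transpose V) ** V = V ** (mat u - D ** (transpose V ** V))"
    by (simp add: matrix_diff_ldistrib matrix_diff_rdistrib matrix_mul_assoc)
  then have "det (mat u - V ** D ** transpose V) * det V = det V * det (mat u - D ** (transpose V ** V))"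
    by (metis det_mul)
  then show ?thesis using assms by simp
qed

lemma sum_group_card:
  fixes f :: "'a set \<Rightarrow> real"
  assumes "finite I"
  shows "(\<Sum>T\<in>Pow I. f T) = (\<Sum>j\<le>card I. \<Sum>T | T \<subseteq> I \<and> card T = card I - j. f T)"
proof -
  have "(\<Sum>T\<in>Pow I. f T) = (\<Sum>j\<le>card I. \<Sum>T | T \<in> Pow I \<and> card I - card T = j. f T)"
    by (rule sum.group[symmetric]) (use assms in auto)
  also have "\<dots> = (\<Sum>j\<le>card I. \<Sum>T | T \<subseteq> I \<and> card T = card I - j. f T)"
  proof (intro sum.cong refl)
    fix j assume "j \<in> {..card I}"
    then have "T \<in> Pow I \<and> card I - card T = j \<longleftrightarrow> T \<subseteq> I \<and> card T = card I - j" for T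
      using card_mono[OF assms, of T] by auto
    then show "{T \<in> Pow I. card I - card T = j} = {T. T \<subseteq> I \<and> card T = card I - j}" by auto
  qed
  finally show ?thesis .
qed

lemma esym_spectrum:
  fixes V :: "real^'n^'n"
  assumes V: "det V \<noteq> 0" and l: "has_spectrum (V ** diag x ** transpose V) l" and r: "r \<le> CARD('n)"
  shows "esym r {1..CARD('n)} l = (\<Sum>T | card T = r. (\<Prod>i\<in>T. x $ i) * minor (transpose V ** V) T)"
proof -
  let ?n = "CARD('n)" and ?G = "transpose V ** V"
  \<comment> \<open>\<open>c j\<close> and \<open>d j\<close> are the coefficients of u^j in two
    expansions of the characteristic polynomial, one by minors and one by linear factors.\<close>
  define c where "c j = (\<Sum>T | card T = ?n - j. (- 1) ^ card T * (\<Prod>i\<in>T. x $ i) * minor ?G T)" for j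
  define d where "d j = (\<Sum>T | T \<subseteq> {1..?n} \<and> card T = ?n - j. (- 1) ^ card T * (\<Prod>i\<in>T. l i))" for j
  have "(\<Sum>j\<le>?n. c j * u ^ j) = (\<Sum>j\<le>?n. d j * u ^ j)" for u
  proof -
    have "(\<Sum>j\<le>?n. c j * u ^ j)
        = (\<Sum>j\<le>?n. \<Sum>T | T \<subseteq> UNIV \<and> card T = ?n - j. u ^ (?n - card T) * ((- 1) ^ card T * (\<Prod>i\<in>T. x $ i) * minor ?G T))"
      unfolding c_def sum_distrib_right by (intro sum.cong) auto
    also have "\<dots> = det (mat u - diag x ** ?G)"
      unfolding det_diag_times_minor
      using sum_group_card[of "UNIV :: 'n set", symmetric, of "\<lambda>T. u ^ (?n - card T) * ((- 1) ^ card T * (\<Prod>i\<in>T. x $ i) * minor ?G T)"]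
      by simp
    also have "\<dots> = (\<Prod>i\<in>{1..?n}. - l i + u)"
      using l by (simp add: has_spectrum_def charpoly_commute[OF V])
    also have "\<dots> = (\<Sum>T\<in>Pow {1..?n}. u ^ (?n - card T) * ((- 1) ^ card T * (\<Prod>i\<in>T. l i)))"
    proof -
      have "card ({1..?n} - T) = ?n - card T" if "T \<subseteq> {1..?n}" for T
        using that by (subst card_Diff_subset) (auto dest: finite_subset)
      then show ?thesis
        by (subst prod_add) (auto simp: prod_uminus intro!: sum.cong)
    qed
    also have "\<dots> = (\<Sum>j\<le>?n. \<Sum>T | T \<subseteq> {1..?n} \<and> card T = ?n - j. u ^ (?n - card T) * ((- 1) ^ card T * (\<Prod>i\<in>T. l i)))"
      by (subst sum_group_card) auto
    also have "\<dots> = (\<Sum>j\<le>?n. d j * u ^ j)"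
      unfolding d_def sum_distrib_right by (intro sum.cong) auto
    finally show ?thesis .
  qed
  then have "c (?n - r) = d (?n - r)" using polyfun_eq_coeffs[of c ?n d] by simp
  moreover have "c (?n - r) = (- 1) ^ r * (\<Sum>T | card T = r. (\<Prod>i\<in>T. x $ i) * minor ?G T)"
    unfolding c_def sum_distrib_left using r by (intro sum.cong) auto
  moreover have "d (?n - r) = (- 1) ^ r * esym r {1..?n} l"
    unfolding d_def esym_def sum_distrib_left using r by (intro sum.cong) auto
  ultimately show ?thesis by simp
qed

lemma matrix_inv_right_left:
  fixes A :: "real^'n^'n"
  assumes "det A \<noteq> 0"
  shows "A ** matrix_inv A = mat 1" "matrix_inv A ** A = mat 1"
proof -
  have "\<exists>A'. A ** A' = mat 1 \<and> A' ** A = mat 1"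
    using assms by (simp add: invertible_det_nz[symmetric] invertible_def)
  then have "A ** matrix_inv A = mat 1 \<and> matrix_inv A ** A = mat 1"
    unfolding matrix_inv_def by (rule someI_ex)
  then show "A ** matrix_inv A = mat 1" "matrix_inv A ** A = mat 1" by auto
qed

text \<open>Jacobi's identity for complementary minors. Right multiplication by \<open>M\<close>
  turns the rows of \<open>N\<close> into identity rows and identity rows into rows of
  \<open>M\<close>, so the two kinds of rows exchange places.\<close>

lemma minor_inverse:
  fixes M :: "real^'n^'n"
  assumes "N ** M = mat 1"
  shows "minor N S * det M = minor M (- S)"
proof -
  have row: "((\<chi> i. a i) ** M) $ i = a i v* M" for a :: "'n \<Rightarrow> real^'n" and i
    by (simp add: vec_eq_iff matrix_matrix_mult_def vector_matrix_mult_def mult.commute)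
  have "N $ i v* M = axis i 1" for i
  proof -
    have "N $ i v* M = (N ** M) $ i" using row[of "\<lambda>i. N $ i" i] by (simp add: vec_lambda_eta)
    then show ?thesis unfolding assms by (simp add: vec_eq_iff mat_def axis_def)
  qed
  moreover have "axis i 1 v* M = M $ i" for i
    by (simp add: vec_eq_iff vector_matrix_mult_def axis_def if_distrib[of "\<lambda>x. x * _"] cong: if_cong)
  ultimately have "(\<chi> i. if i \<in> S then N $ i else axis i 1) ** M = (\<chi> i. if i \<in> - S then M $ i else axis i 1)"
    by (simp add: vec_eq_iff[of "(\<chi> i. if i \<in> S then N $ i else axis i 1) ** M"] row)
  then show ?thesis by (simp only: minor_def det_mul[symmetric])
qed

lemma minor_UNIV: "minor G UNIV = det G"
  by (simp add: minor_def)

subsection \<open>Rank-one updates of matrices above the identity\<close>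

text \<open>P \<ge> I in the Loewner order. Nonnegative rank-one updates preserve it, and it gives
  both positive determinants and an inverse below the identity.\<close>

definition above_identity :: "real^'n^'n \<Rightarrow> bool" where
  "above_identity P \<longleftrightarrow> transpose P = P \<and> (\<forall>v. v \<bullet> v \<le> v \<bullet> (P *v v))"

lemma above_identity_posdef:
  fixes P :: "real^'n^'n"
  assumes "above_identity P"
  shows "posdef P"
  unfolding posdef_def
proof (intro conjI allI impI)
  fix v :: "real^'n" assume "v \<noteq> 0"
  then have "0 < v \<bullet> v" by simp
  also have "v \<bullet> v \<le> v \<bullet> (P *v v)" using assms by (simp add: above_identity_def)
  finally show "0 < v \<bullet> (P *v v)" .
qed (use assms in \<open>simp add: above_identity_def\<close>)

lemma above_identity_mat_1: "above_identity (mat 1)"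
  by (simp add: above_identity_def)

lemma above_identity_update:
  assumes "above_identity P" "0 \<le> c"
  shows "above_identity (P + c *\<^sub>R outer_prod b)"
proof -
  have "v \<bullet> v \<le> v \<bullet> ((P + c *\<^sub>R outer_prod b) *v v)" for v
  proof -
    have "(P + c *\<^sub>R outer_prod b) *v v = P *v v + (c * (b \<bullet> v)) *\<^sub>R b"
      by (simp add: matrix_vector_mult_add_rdistrib scaleR_matrix_vector_assoc[symmetric] outer_prod_vec)
    then have "v \<bullet> ((P + c *\<^sub>R outer_prod b) *v v) = v \<bullet> (P *v v) + c * (b \<bullet> v)\<^sup>2"
      by (simp add: inner_add_right inner_commute power2_eq_square)
    moreover have "0 \<le> c * (b \<bullet> v)\<^sup>2" using assms by simp
    ultimately show ?thesis using assms(1) by (auto simp: above_identity_def intro: order_trans)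
  qed
  moreover have "transpose (P + c *\<^sub>R outer_prod b) = P + c *\<^sub>R outer_prod b"
    using assms(1) by (simp add: above_identity_def vec_eq_iff transpose_def mult.commute)
  ultimately show ?thesis by (simp add: above_identity_def)
qed

lemma above_identity_sum:
  assumes "above_identity P" "finite T" "\<And>i. i \<in> T \<Longrightarrow> 0 \<le> c i"
  shows "above_identity (P + (\<Sum>i\<in>T. c i *\<^sub>R outer_prod (b i)))"
  using assms(2,3)
proof (induction T rule: finite_induct)
  case (insert k T)
  then show ?case
    using above_identity_update[of "P + (\<Sum>i\<in>T. c i *\<^sub>R outer_prod (b i))" "c k" "b k"]
    by (simp add: ac_simps)
qed (use assms(1) in simp)

lemma nonsingular_solve:
  fixes P :: "real^'n^'n"
  assumes "det P \<noteq> 0"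
  obtains w where "P *v w = b"
proof
  show "P *v (matrix_inv P *v b) = b"
    using matrix_inv_right_left(1)[OF assms] by (simp add: matrix_vector_mul_assoc)
qed

lemma det_outer_prod_update:
  assumes "P *v w = b"
  shows "det (P + c *\<^sub>R outer_prod b) = det P * (1 + c * (w \<bullet> b))"
proof -
  have "P *v (c *\<^sub>R w) = c *\<^sub>R b" using assms by (simp add: matrix_vector_mult_scaleR)
  from det_rank_one_update[OF this, of b]
  have "det (P + (\<chi> i j. (c *\<^sub>R b) $ i * b $ j)) = det P * (1 + c * (w \<bullet> b))" by simp
  moreover have "c *\<^sub>R outer_prod b = (\<chi> i j. (c *\<^sub>R b) $ i * b $ j)"
    by (simp add: vec_eq_iff)
  ultimately show ?thesis by simp
qed

text \<open>The update factor is 1 + c (w . b) with P w = b. From P \<ge> I one gets |w|^2 \<le> w .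
  b, and then |b - w|^2 \<ge> 0 yields w . b \<le> |b|^2.\<close>

lemma det_update_bounds:
  assumes P: "above_identity P" and c: "0 \<le> c" "c \<le> 1"
  shows "det P \<le> det (P + c *\<^sub>R outer_prod b)" "det (P + c *\<^sub>R outer_prod b) \<le> det P * (1 + b \<bullet> b)"
proof -
  have d: "det P > 0" by (intro posdef_det_pos above_identity_posdef P)
  then obtain w where w: "P *v w = b" using nonsingular_solve[of P b] by auto
  have ww: "w \<bullet> w \<le> w \<bullet> b" using P by (auto simp: above_identity_def w[symmetric])
  then have nn: "0 \<le> w \<bullet> b" using inner_ge_zero[of w] by linarith
  have "0 \<le> (b - w) \<bullet> (b - w)" by simp
  then have "w \<bullet> b \<le> b \<bullet> b"
    using ww by (simp add: inner_diff_left inner_diff_right inner_commute[of b w])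
  moreover have "c * (w \<bullet> b) \<le> w \<bullet> b" using c nn by (simp add: mult_left_le_one_le)
  ultimately show "det P \<le> det (P + c *\<^sub>R outer_prod b)"
    "det (P + c *\<^sub>R outer_prod b) \<le> det P * (1 + b \<bullet> b)"
    unfolding det_outer_prod_update[OF w] using d c nn by (auto simp: algebra_simps)
qed

lemma det_sum_bounds:
  assumes P: "above_identity P" and "finite T" "\<And>i. i \<in> T \<Longrightarrow> 0 \<le> c i \<and> c i \<le> 1"
    and \<delta>: "\<And>i. i \<in> T \<Longrightarrow> b i \<bullet> b i \<le> \<delta>"
  shows "det P \<le> det (P + (\<Sum>i\<in>T. c i *\<^sub>R outer_prod (b i)))
    \<and> det (P + (\<Sum>i\<in>T. c i *\<^sub>R outer_prod (b i))) \<le> det P * (1 + \<delta>) ^ card T"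
  using assms(2,3,4)
proof (induction T rule: finite_induct)
  case (insert k T)
  define Q where "Q = P + (\<Sum>i\<in>T. c i *\<^sub>R outer_prod (b i))"
  have Q: "above_identity Q" unfolding Q_def using insert by (intro above_identity_sum P) auto
  have e: "P + (\<Sum>i\<in>insert k T. c i *\<^sub>R outer_prod (b i)) = Q + c k *\<^sub>R outer_prod (b k)"
    using insert.hyps by (simp add: Q_def ac_simps)
  have IH: "det P \<le> det Q" "det Q \<le> det P * (1 + \<delta>) ^ card T"
    unfolding Q_def using insert by auto
  have dP: "det P > 0" by (intro posdef_det_pos above_identity_posdef P)
  have bk: "b k \<bullet> b k \<le> \<delta>" "0 \<le> b k \<bullet> b k" using insert.prems by auto
  have "det Q * (1 + b k \<bullet> b k) \<le> (det P * (1 + \<delta>) ^ card T) * (1 + \<delta>)"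
    using IH bk dP by (intro mult_mono) auto
  then show ?case
    unfolding e using det_update_bounds[OF Q, of "c k" "b k"] IH insert by (auto simp: mult_ac)
qed simp

text \<open>Both determinants are built up one rank-one update at a time; the two update factors agree
  because \<open>w\<close> solving the first linear system makes \<open>B w\<close> solve the second one.\<close>

lemma minor_gram:
  fixes B :: "real^'n^'d"
  shows "minor (mat 1 + transpose B ** B) S = det (mat 1 + (\<Sum>i\<in>S. outer_prod (column i B)))"
proof -
  let ?K = "transpose B ** B"
  define D where "D S = diag (\<chi> i. if i \<in> S then 1 else 0)" for S :: "'n set"
  have "det (mat 1 + D S ** ?K) = det (mat 1 + B ** D S ** transpose B)" if "finite S" for S
    using that
  proof (induction S rule: finite_induct)
    case empty
    have "D {} = 0" by (simp add: D_def diag_def vec_eq_iff)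
    moreover have "(0::real^'n^'n) ** ?K = 0" "B ** 0 ** transpose B = (0::real^'d^'d)"
      by (simp_all add: vec_eq_iff matrix_matrix_mult_def)
    ultimately show ?case by simp
  next
    case (insert k S)
    let ?N = "\<lambda>S. mat 1 + D S ** ?K" and ?P = "\<lambda>S. mat 1 + B ** D S ** transpose B"
    have P: "?P S = mat 1 + (\<Sum>i\<in>S. outer_prod (column i B))" for S
      by (simp add: D_def sum_outer_prod_subset)
    have "above_identity (?P S)"
      unfolding P using above_identity_sum[OF above_identity_mat_1, of S "\<lambda>_. 1"] by simp
    then have "det (?P S) > 0" by (intro posdef_det_pos above_identity_posdef)
    \<comment> \<open>\<open>?N S\<close> need not be symmetric, so its nonsingularity is taken from
      \<open>?P S\<close> through the induction hypothesis.\<close>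
    then have "det (?N S) \<noteq> 0" using insert.IH by simp
    then obtain w where w: "?N S *v w = axis k 1" by (rule nonsingular_solve)
    have colk: "B *v axis k 1 = column k B" by (rule matrix_vector_mult_basis)
    have "?P S ** B = B ** ?N S"
      by (simp add: matrix_add_ldistrib matrix_add_rdistrib matrix_mul_assoc)
    then have w': "?P S *v (B *v w) = column k B"
      using w colk by (simp add: matrix_vector_mul_assoc) (simp flip: matrix_vector_mul_assoc)
    have "D (insert k S) ** ?K = D S ** ?K + (\<chi> i j. axis k 1 $ i * ?K $ k $ j)"
      using insert.hyps
      by (auto simp: vec_eq_iff D_def diag_def axis_def matrix_matrix_mult_def[of "\<chi> i j. _ i j"]
          if_distrib[of "\<lambda>x. x * _"] cong: if_cong)
    then have "det (?N (insert k S)) = det (?N S + (\<chi> i j. axis k 1 $ i * ?K $ k $ j))"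
      by (simp add: add.assoc)
    also have "\<dots> = det (?N S) * (1 + w \<bullet> ?K $ k)"
      by (rule det_rank_one_update[OF w])
    also have "?K $ k = transpose B *v column k B"
      by (simp add: vec_eq_iff matrix_matrix_mult_def matrix_vector_mult_def transpose_def column_def mult.commute)
    also have "w \<bullet> (transpose B *v column k B) = (B *v w) \<bullet> column k B"
      by (metis dot_lmul_matrix inner_commute transpose_matrix_vector)
    also have "det (?N S) * (1 + (B *v w) \<bullet> column k B) = det (?P S + 1 *\<^sub>R outer_prod (column k B))"
      unfolding insert.IH det_outer_prod_update[OF w'] by simp
    also have "?P S + 1 *\<^sub>R outer_prod (column k B) = ?P (insert k S)"
      unfolding P using insert.hyps by (simp add: ac_simps)
    finally show ?case .
  qed
  moreover have "(\<chi> i. if i \<in> S then (mat 1 + ?K) $ i else axis i 1) = mat 1 + D S ** ?K"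
    by (auto simp: vec_eq_iff D_def diag_def axis_def mat_def matrix_matrix_mult_def[of "\<chi> i j. _ i j"]
          if_distrib[of "\<lambda>x. x * _"] cong: if_cong)
  ultimately show ?thesis
    unfolding minor_def sum_outer_prod_subset D_def by simp
qed

subsection \<open>The factorization bound\<close>

abbreviation weighted_gram :: "real^'n^'n \<Rightarrow> real^'n \<Rightarrow> real^'n^'n" where
  "weighted_gram V x \<equiv> V ** diag x ** transpose V"

lemma weighted_gram_symmetric: "transpose (weighted_gram V x) = weighted_gram V x"
proof -
  have "transpose (diag x) = diag x" by (simp add: vec_eq_iff transpose_def diag_def)
  then show ?thesis by (simp add: matrix_transpose_mul matrix_mul_assoc)
qed

lemma weighted_gram_psd:
  assumes "\<And>i. 0 \<le> x $ i"
  shows "0 \<le> v \<bullet> (weighted_gram V x *v v)"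
  unfolding diagonalized_inner using assms by (intro sum_nonneg) auto

lemma split_value_cong:
  assumes "\<And>i. 1 \<le> i \<Longrightarrow> i \<le> n \<Longrightarrow> l i = l' i" "k < r" "r \<le> n"
  shows "split_value n r l k = split_value n r l' k"
proof -
  have "tavg n r l k = tavg n r l' k" unfolding tavg_def using assms by simp
  moreover have "(\<Prod>i = 1..k. l i) = (\<Prod>i = 1..k. l' i)" using assms by simp
  ultimately show ?thesis by (simp only: split_value_def)
qed

lemma weak_split_cong:
  assumes "\<And>i. 1 \<le> i \<Longrightarrow> i \<le> n \<Longrightarrow> l i = l' i" "r \<le> n"
  shows "weak_split n r l k \<longleftrightarrow> weak_split n r l' k"
proof -
  have "tavg n r l k = tavg n r l' k" unfolding tavg_def using assms by simp
  then show ?thesis unfolding weak_split_def using assms by (cases "k = 0") auto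
qed

section \<open>\<open>f_fun\<close> of a positive semidefinite matrix\<close>

context
  fixes X :: "real^'n^'n" and r :: nat
  assumes sym: "transpose X = X" and psd: "\<And>v. 0 \<le> v \<bullet> (X *v v)"
    and r: "0 < r" "r \<le> CARD('n)"
begin

lemma eigval_sorted_nonneg: "sorted_nonneg (CARD('n)) (eigval X)"
  using eigval_antimono[OF sym] eigval_nonneg[OF sym psd] by (simp add: sorted_nonneg_def)

private lemmas eigval_split_facts = eigval_sorted_nonneg r

lemma split_index_strict: "strict_split (CARD('n)) r (eigval X) (split_index r X)"
proof -
  have e: "split_index r X = (THE k. strict_split (CARD('n)) r (eigval X) k)"
    by (simp add: split_index_def strict_split_def tail_avg_def tavg_def)
  obtain k where "strict_split (CARD('n)) r (eigval X) k"
    using strict_split_exists[OF eigval_split_facts] by blast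
  then show ?thesis
    unfolding e by (rule theI) (use strict_split_unique[OF eigval_split_facts] \<open>strict_split _ _ _ k\<close> in blast)
qed

lemma f_fun_split_value: "f_fun r X = split_value (CARD('n)) r (eigval X) (split_index r X)"
  by (simp add: f_fun_def split_value_def tail_avg_def tavg_def Let_def)

lemma f_fun_weak:
  "weak_split (CARD('n)) r (eigval X) k \<Longrightarrow> f_fun r X = split_value (CARD('n)) r (eigval X) k"
  unfolding f_fun_split_value
  using split_value_weak[OF eigval_split_facts split_index_strict] by simp

lemma f_fun_le_esym: "f_fun r X \<le> esym r {1..CARD('n)} (eigval X)"
  unfolding f_fun_split_value
  using split_value_le_esym[OF eigval_split_facts] strict_imp_weak_split[OF split_index_strict] by blast

lemma f_fun_low_rank:
  assumes "\<And>i. r < i \<Longrightarrow> i \<le> CARD('n) \<Longrightarrow> eigval X i = 0"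
  shows "f_fun r X = esym r {1..CARD('n)} (eigval X)"
  unfolding f_fun_split_value
  using split_value_low_rank[OF eigval_split_facts split_index_strict] assms by blast

lemma f_fun_pos:
  assumes "esym r {1..CARD('n)} (eigval X) > 0"
  shows "f_fun r X > 0"
  unfolding f_fun_split_value
  using split_value_pos[OF eigval_split_facts] esym_pos_imp[OF eigval_split_facts assms] split_index_strict
  by (simp add: strict_split_def)

end

lemma indicator_feasible:
  assumes "card S = s"
  shows "((\<chi> i. if i \<in> S then 1 else 0) :: real^'m) \<in> feasible s"
  using assms by (simp add: feasible_def sum.If_cases)

lemma max_on_eqI:
  assumes "m \<in> S" "\<And>y. y \<in> S \<Longrightarrow> g y \<le> g m"
  shows "max_on S g = g m"
  unfolding max_on_def using assms by (intro Greatest_equality) auto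

section \<open>Maximising \<open>f_fun\<close> over weighted Gram matrices\<close>

context
  fixes V :: "real^'n^'n" and r :: nat
  assumes V: "det V \<noteq> 0" and minor_pos: "\<And>T. minor (transpose V ** V) T > 0"
    and r: "0 < r" "r \<le> CARD('n)"
begin

private abbreviation (input) "G \<equiv> transpose V ** V"

lemma esym_weighted_gram:
  "j \<le> CARD('n) \<Longrightarrow> esym j {1..CARD('n)} (eigval (weighted_gram V x))
    = (\<Sum>T | card T = j. (\<Prod>i\<in>T. x $ i) * minor G T)"
  by (intro esym_spectrum V has_spectrum_eigval weighted_gram_symmetric)

lemma f_fun_weighted_gram_le:
  assumes "\<And>i. 0 \<le> x $ i"
  shows "f_fun r (weighted_gram V x) \<le> (\<Sum>T | card T = r. (\<Prod>i\<in>T. x $ i) * minor G T)"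
  using f_fun_le_esym[OF weighted_gram_symmetric[of V x] weighted_gram_psd[OF assms] r]
  unfolding esym_weighted_gram[OF r(2)] .

lemma f_fun_indicator:
  assumes S: "card S = r"
  shows "f_fun r (weighted_gram V (\<chi> i. if i \<in> S then 1 else 0)) = minor G S"
proof -
  let ?x = "(\<chi> i. if i \<in> S then 1 else 0) :: real^'n" and ?n = "CARD('n)"
  let ?l = "eigval (weighted_gram V ?x)"
  note psd = weighted_gram_psd[of ?x _ V]
  have vanish: "(\<Prod>i\<in>T. ?x $ i) = 0" if "\<not> T \<subseteq> S" for T
    using that by (intro prod_zero) auto
  \<comment> \<open>The rank is read off the symmetric functions. A nonzero i-th eigenvalue makes
    the first \<open>i\<close> eigenvalues positive, hence \<open>esym i\<close> positive; but no
    \<open>i\<close>-set fits inside \<open>S\<close>, so all terms of its expansion vanish.\<close>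
  have zero: "?l i = 0" if i: "r < i" "i \<le> ?n" for i
  proof (rule ccontr)
    assume "?l i \<noteq> 0"
    have nonneg: "0 \<le> ?l j" if "1 \<le> j" "j \<le> ?n" for j
      using that psd by (intro eigval_nonneg weighted_gram_symmetric) auto
    then have "0 < ?l i" using \<open>?l i \<noteq> 0\<close> i by (metis One_nat_def Suc_leI gr_zeroI less_le not_less0)
    then have "0 < ?l j" if "j \<in> {1..i}" for j
      using eigval_antimono[OF weighted_gram_symmetric, of j i V ?x] that i by force
    then have "0 < (\<Prod>j\<in>{1..i}. ?l j)" by (rule prod_pos)
    also have "\<dots> \<le> esym i {1..?n} ?l"
      unfolding esym_def using i nonneg by (intro member_le_sum prod_nonneg) auto
    also have "\<dots> = 0"
      unfolding esym_weighted_gram[OF i(2)]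
    proof (intro sum.neutral ballI)
      fix T assume "T \<in> {T :: 'n set. card T = i}"
      then have "\<not> T \<subseteq> S" using card_mono[of S T] S i(1) by auto
      then show "(\<Prod>i\<in>T. ?x $ i) * minor G T = 0" using vanish[OF \<open>\<not> T \<subseteq> S\<close>] by simp
    qed
    finally show False by simp
  qed
  have "f_fun r (weighted_gram V ?x) = esym r {1..?n} ?l"
    by (rule f_fun_low_rank) (use weighted_gram_symmetric psd r zero in auto)
  also have "\<dots> = (\<Sum>T\<in>{S}. (\<Prod>i\<in>T. ?x $ i) * minor G T)"
    unfolding esym_weighted_gram[OF r(2)]
  proof (rule sum.mono_neutral_right)
    show "\<forall>T\<in>{T. card T = r} - {S}. (\<Prod>i\<in>T. ?x $ i) * minor G T = 0"
    proof
      fix T assume "T \<in> {T :: 'n set. card T = r} - {S}"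
      then have "\<not> T \<subseteq> S" using card_subset_eq[of S T] S by auto
      then show "(\<Prod>i\<in>T. ?x $ i) * minor G T = 0" using vanish[OF \<open>\<not> T \<subseteq> S\<close>] by simp
    qed
  qed (use S in auto)
  finally show ?thesis by simp
qed

text \<open>Entries at most 1 with sum \<open>r\<close> leave at least \<open>r\<close> of them
  nonzero, and an \<open>r\<close>-set of such indices gives a positive term.\<close>

lemma f_fun_feasible_pos:
  assumes x: "x \<in> feasible r"
  shows "f_fun r (weighted_gram V x) > 0"
proof -
  have x01: "0 \<le> x $ i" "x $ i \<le> 1" for i using x by (auto simp: feasible_def)
  let ?Z = "{i. x $ i \<noteq> 0}"
  have "(\<Sum>i\<in>?Z. x $ i) = (\<Sum>i\<in>UNIV. x $ i)"
    by (rule sum.mono_neutral_left) auto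
  then have "real r = (\<Sum>i\<in>?Z. x $ i)"
    using x by (simp add: feasible_def)
  also have "\<dots> \<le> real (card ?Z)" using sum_mono[of ?Z "\<lambda>i. x $ i" "\<lambda>_. 1"] x01 by simp
  finally obtain T where T: "T \<subseteq> ?Z" "card T = r" by (metis obtain_subset_with_card_n of_nat_le_iff)
  have "0 < (\<Prod>i\<in>T. x $ i) * minor G T"
    using T x01 minor_pos by (intro mult_pos_pos prod_pos) (auto simp: less_le)
  also have "\<dots> \<le> (\<Sum>T | card T = r. (\<Prod>i\<in>T. x $ i) * minor G T)"
    using T x01 minor_pos by (intro member_le_sum mult_nonneg_nonneg prod_nonneg) (auto intro: less_imp_le)
  finally have "0 < esym r {1..CARD('n)} (eigval (weighted_gram V x))"
    by (simp only: esym_weighted_gram[OF r(2)])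
  then show ?thesis
    by (intro f_fun_pos weighted_gram_symmetric weighted_gram_psd x01 r)
qed

text \<open>Eigenvalues of the weighted Gram matrix are not expressed as functions of \<open>x\<close>; instead the
  pairs of a feasible point and a sorted spectrum form a compact set, on which the objective is
  piecewise (by split index) a continuous function of the spectrum.\<close>

lemma f_fun_attains_max:
  "\<exists>m\<in>feasible r. \<forall>x\<in>feasible r. f_fun r (weighted_gram V x) \<le> f_fun r (weighted_gram V m)"
proof -
  let ?n = "CARD('n)"
  \<comment> \<open>Transports the indices 1..n to the index type, so that a spectrum becomes a
    point of a Euclidean space.\<close>
  obtain e :: "nat \<Rightarrow> 'n" where e: "bij_betw e {1..?n} UNIV"
    using finite_same_card_bij[of "{1..?n}" "UNIV :: 'n set"] by auto
  define ch where "ch x t = (\<Sum>T\<in>UNIV. t ^ (?n - card T) * ((- 1) ^ card T * (\<Prod>i\<in>T. x $ i) * minor G T))"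
    for x :: "real^'n" and t
  have ch: "det (mat t - weighted_gram V x) = ch x t" for x t
    by (simp only: ch_def charpoly_commute[OF V] det_diag_times_minor)
  define K where "K k = {p :: (real^'n) \<times> (real^'n). fst p \<in> feasible r
    \<and> has_spectrum (weighted_gram V (fst p)) (\<lambda>i. snd p $ e i) \<and> weak_split ?n r (\<lambda>i. snd p $ e i) k}" for k
  define h where "h k p = split_value ?n r (\<lambda>i. snd p $ e i) k" for k and p :: "(real^'n) \<times> (real^'n)"
  have eig: "eigval (weighted_gram V (fst p)) i = snd p $ e i" if "p \<in> K k" "1 \<le> i" "i \<le> ?n" for p k i
    using that eigval_eqI[of "weighted_gram V (fst p)" "\<lambda>i. snd p $ e i" i] by (auto simp: K_def)
  have f_eq: "f_fun r (weighted_gram V (fst p)) = h k p" if p: "p \<in> K k" for p k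
  proof -
    have k: "k < r" "weak_split ?n r (eigval (weighted_gram V (fst p))) k"
      using p weak_split_cong[of ?n "eigval (weighted_gram V (fst p))" "\<lambda>i. snd p $ e i" r k] eig[OF p] r
      by (auto simp: K_def weak_split_def)
    have "f_fun r (weighted_gram V (fst p)) = split_value ?n r (eigval (weighted_gram V (fst p))) k"
      by (rule f_fun_weak[OF weighted_gram_symmetric weighted_gram_psd r k(2)])
        (use p in \<open>auto simp: K_def feasible_def\<close>)
    then show ?thesis unfolding h_def using split_value_cong[OF eig[OF p] k(1) r(2)] by simp
  qed
  \<comment> \<open>All conditions are weak inequalities or equations between continuous functions
    of the pair: the characteristic polynomial has been replaced by its expansion \<open>ch\<close>,
    polynomial in \<open>x\<close>.\<close>
  have closed: "closed (K k)" for k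
    unfolding K_def feasible_def has_spectrum_def ch weak_split_def mem_Collect_eq tavg_def ch_def imp_conv_disj
    by (intro closed_Collect_conj closed_Collect_all closed_Collect_disj closed_Collect_const
        closed_Collect_le closed_Collect_eq continuous_intros)
  \<comment> \<open>Bounds the trace of every weighted Gram matrix with weights at most 1, hence
    each of its nonnegative eigenvalues.\<close>
  define c where "c = (\<Sum>T | card T = 1. minor G T)"
  have "K k \<subseteq> cbox 0 1 \<times> cbox 0 (\<chi> i. c)" for k
  proof
    fix p assume p: "p \<in> K k"
    have x: "0 \<le> fst p $ i" "fst p $ i \<le> 1" for i using p by (auto simp: K_def feasible_def)
    have "0 \<le> snd p $ j \<and> snd p $ j \<le> c" for j
    proof -
      obtain i where i: "i \<in> {1..?n}" "e i = j" using e by (metis UNIV_I bij_betw_imp_surj_on imageE)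
      let ?l = "eigval (weighted_gram V (fst p))"
      have nn: "0 \<le> ?l i" if "i \<in> {1..?n}" for i
        using that x by (intro eigval_nonneg weighted_gram_symmetric weighted_gram_psd) auto
      have "?l i = (\<Prod>i\<in>{i}. ?l i)" by simp
      also have "\<dots> \<le> esym 1 {1..?n} ?l"
        unfolding esym_def using i nn by (intro member_le_sum prod_nonneg) auto
      also have "\<dots> = (\<Sum>T | card T = 1. (\<Prod>i\<in>T. fst p $ i) * minor G T)"
        by (rule esym_weighted_gram) (use r in simp)
      also have "\<dots> \<le> c"
        unfolding c_def using x minor_pos
        by (intro sum_mono mult_left_le_one_le prod_le_1 prod_nonneg) (auto intro: less_imp_le)
      finally show ?thesis using nn[of i] i eig[OF p, of i] by auto
    qed
    then show "p \<in> cbox 0 1 \<times> cbox 0 (\<chi> i. c)"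
      using x by (auto simp: mem_Times_iff mem_box_cart)
  qed
  then have compact: "compact (K k)" for k
    using closed by (metis compact_Int_closed compact_Times compact_cbox inf.absorb2)
  have "continuous_on (K k) (h k)" for k
    unfolding h_def split_value_def tavg_def by (intro continuous_intros)
  then have "compact (\<Union>k<r. h k ` K k)"
    using compact by (intro compact_UN compact_continuous_image) auto
  moreover have img: "(\<Union>k<r. h k ` K k) = (\<lambda>x. f_fun r (weighted_gram V x)) ` feasible r"
  proof (intro equalityI subsetI)
    fix y assume "y \<in> (\<Union>k<r. h k ` K k)"
    then obtain k p where "p \<in> K k" "y = h k p" by blast
    then show "y \<in> (\<lambda>x. f_fun r (weighted_gram V x)) ` feasible r"
      using f_eq[of p k] by (intro image_eqI[of _ _ "fst p"]) (auto simp: K_def)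
  next
    fix y assume "y \<in> (\<lambda>x. f_fun r (weighted_gram V x)) ` feasible r"
    then obtain x where x: "x \<in> feasible r" "y = f_fun r (weighted_gram V x)" by blast
    let ?l = "eigval (weighted_gram V x)" and ?k = "split_index r (weighted_gram V x)"
    \<comment> \<open>The point \<open>x\<close> paired with its own spectrum; the split index of
      its matrix tells which \<open>K k\<close> contains it.\<close>
    define p where "p = (x, \<chi> j. ?l (inv_into {1..?n} e j))"
    have l: "snd p $ e i = ?l i" if "1 \<le> i" "i \<le> ?n" for i
      using e that by (simp add: p_def bij_betw_def)
    have ws: "weak_split ?n r ?l ?k"
      by (intro strict_imp_weak_split split_index_strict weighted_gram_symmetric weighted_gram_psd r)
        (use x in \<open>auto simp: feasible_def\<close>)
    have "has_spectrum (weighted_gram V x) (\<lambda>i. snd p $ e i)"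
      using has_spectrum_eigval[OF weighted_gram_symmetric, of V x] l by (auto simp: has_spectrum_def)
    moreover have "weak_split ?n r (\<lambda>i. snd p $ e i) ?k"
      using ws weak_split_cong[of ?n "\<lambda>i. snd p $ e i" ?l r ?k] l r by simp
    ultimately have "p \<in> K ?k" using x by (simp add: K_def p_def)
    moreover have "y = h ?k p" using f_eq[OF calculation] x by (simp add: p_def)
    moreover have "?k < r" using ws by (simp add: weak_split_def)
    ultimately show "y \<in> (\<Union>k<r. h k ` K k)" by blast
  qed
  moreover have "feasible r \<noteq> ({} :: (real^'n) set)"
  proof -
    have "(\<chi> i. real r / real ?n) \<in> (feasible r :: (real^'n) set)"
      using r by (simp add: feasible_def)
    then show ?thesis by blast
  qed
  ultimately have "\<exists>M\<in>(\<lambda>x. f_fun r (weighted_gram V x)) ` feasible r.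
      \<forall>y\<in>(\<lambda>x. f_fun r (weighted_gram V x)) ` feasible r. y \<le> M"
    by (intro compact_attains_sup) auto
  then show ?thesis by blast
qed

text \<open>\<open>max_on\<close> is a \<open>GREATEST\<close>, so its value is known only once a
  maximiser is found; the logarithm preserves it because \<open>f_fun\<close> is positive on the
  feasible set.\<close>

lemma max_log_f_attained:
  obtains m where "m \<in> feasible r" "max_log_f r V = ln (f_fun r (weighted_gram V m))"
    "\<And>x. x \<in> feasible r \<Longrightarrow> f_fun r (weighted_gram V x) \<le> f_fun r (weighted_gram V m)"
proof -
  obtain m where m: "m \<in> feasible r"
    "\<And>x. x \<in> feasible r \<Longrightarrow> f_fun r (weighted_gram V x) \<le> f_fun r (weighted_gram V m)"
    using f_fun_attains_max by blast
  have "max_log_f r V = ln (f_fun r (weighted_gram V m))"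
    unfolding max_log_f_def sum_outer_prod_columns
    using m f_fun_feasible_pos by (intro max_on_eqI) (auto simp: ln_le_cancel_iff)
  then show ?thesis using that m by blast
qed

lemma ln_minor_le_max_log_f:
  assumes "card S = r"
  shows "ln (minor G S) \<le> max_log_f r V"
proof -
  obtain m where m: "m \<in> feasible r" "max_log_f r V = ln (f_fun r (weighted_gram V m))"
    "\<And>x. x \<in> feasible r \<Longrightarrow> f_fun r (weighted_gram V x) \<le> f_fun r (weighted_gram V m)"
    using max_log_f_attained by blast
  have "minor G S \<le> f_fun r (weighted_gram V m)"
    using m(3)[OF indicator_feasible[OF assms]] f_fun_indicator[OF assms] by simp
  then show ?thesis unfolding m(2) using minor_pos[of S] by simp
qed

lemma max_log_f_le:
  assumes c: "\<And>S. card S = r \<Longrightarrow> minor G S \<le> c"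
  shows "max_log_f r V \<le> ln c + real r * ln (real r / real CARD('n)) + ln (real (CARD('n) choose r))"
proof -
  let ?n = "CARD('n)"
  obtain m where m: "m \<in> feasible r" "max_log_f r V = ln (f_fun r (weighted_gram V m))"
    using max_log_f_attained by blast
  have m01: "0 \<le> m $ i" for i using m(1) by (auto simp: feasible_def)
  have ms: "(\<Sum>i\<in>UNIV. m $ i) = real r" using m(1) by (simp add: feasible_def)
  obtain S :: "'n set" where "card S = r" using obtain_subset_with_card_n[of r "UNIV :: 'n set"] r by auto
  then have "c > 0" using c[of S] minor_pos[of S] by linarith
  have "f_fun r (weighted_gram V m) \<le> (\<Sum>T | card T = r. (\<Prod>i\<in>T. m $ i) * minor G T)"
    by (rule f_fun_weighted_gram_le[OF m01])
  also have "\<dots> \<le> (\<Sum>T | card T = r. (\<Prod>i\<in>T. m $ i) * c)"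
    using c m01 by (intro sum_mono mult_left_mono prod_nonneg) auto
  also have "\<dots> = c * esym r UNIV (\<lambda>i. m $ i)"
    by (simp add: esym_def sum_distrib_left mult.commute)
  also have "\<dots> \<le> c * (real (?n choose r) * (real r / real ?n) ^ r)"
    using esym_maclaurin[of "UNIV :: 'n set" "\<lambda>i. m $ i" r] m01 ms \<open>c > 0\<close> by (intro mult_left_mono) auto
  finally have le: "f_fun r (weighted_gram V m) \<le> c * (real (?n choose r) * (real r / real ?n) ^ r)" .
  have ch: "0 < real (?n choose r)" using r by simp
  have rn: "0 < real r / real ?n" using r by simp
  have "max_log_f r V \<le> ln (c * (real (?n choose r) * (real r / real ?n) ^ r))"
    unfolding m(2) using le f_fun_feasible_pos[OF m(1)] by (subst ln_le_cancel_iff) linarith+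
  also have "\<dots> = ln c + real r * ln (real r / real ?n) + ln (real (?n choose r))"
    using \<open>c > 0\<close> ch rn by (simp add: ln_mult_pos ln_realpow del: ln_div)
  finally show ?thesis .
qed

end

subsection \<open>The three relaxations\<close>

context
  fixes C :: "real^'d^'d" and A :: "real^'n^'d"
  assumes C: "posdef C"
begin

private abbreviation (input) "B \<equiv> B_mat C A"
private abbreviation (input) "M \<equiv> M_mat C A"

lemma posdef_sqrt_mult_B_mat: "posdef_sqrt C ** B = A"
  using posdef_det_pos[OF posdef_sqrt(1)[OF C]]
  by (simp add: B_mat_def matrix_mul_assoc matrix_inv_right_left)

text \<open>Identifies the matrix defining \<delta> with B^T B, using that R C^-1 R = I for the
  square root R of \<open>C\<close>.\<close>

lemma gram_B_mat: "transpose A ** matrix_inv C ** A = transpose B ** B"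
proof -
  let ?R = "posdef_sqrt C"
  have "?R ** (?R ** matrix_inv C) = mat 1"
    using posdef_det_pos[OF C] posdef_sqrt(2)[OF C] by (simp add: matrix_mul_assoc matrix_inv_right_left)
  then have inv: "?R ** matrix_inv C ** ?R = mat 1"
    by (simp add: matrix_left_right_inverse)
  have "transpose A ** matrix_inv C ** A = transpose (?R ** B) ** matrix_inv C ** (?R ** B)"
    by (simp only: posdef_sqrt_mult_B_mat)
  also have "\<dots> = transpose B ** (?R ** matrix_inv C ** ?R) ** B"
    by (simp add: matrix_transpose_mul posdef_symmetric[OF posdef_sqrt(1)[OF C]] matrix_mul_assoc)
  finally show ?thesis by (simp add: inv)
qed

text \<open>Pulling the square root R of \<open>C\<close> out on both sides leaves the identity plus
  outer products of columns of \<open>B\<close>, to which \<open>minor_gram\<close> applies.\<close>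

lemma det_add_outer_prods:
  "det (C + (\<Sum>i\<in>S. outer_prod (column i A))) = det C * minor M S"
proof -
  let ?R = "posdef_sqrt C" and ?D = "diag (\<chi> i. if i \<in> S then 1 else 0) :: real^'n^'n"
  have R: "transpose ?R = ?R" "?R ** ?R = C"
    using posdef_sqrt[OF C] posdef_symmetric by auto
  have "C + (\<Sum>i\<in>S. outer_prod (column i A)) = ?R ** ?R + (?R ** B) ** ?D ** transpose (?R ** B)"
    by (simp only: sum_outer_prod_subset posdef_sqrt_mult_B_mat R)
  also have "\<dots> = ?R ** (mat 1 + B ** ?D ** transpose B) ** ?R"
    by (simp add: matrix_add_ldistrib matrix_add_rdistrib matrix_transpose_mul R(1) matrix_mul_assoc)
  finally have "det (C + (\<Sum>i\<in>S. outer_prod (column i A)))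
      = det (?R ** ?R) * det (mat 1 + B ** ?D ** transpose B)"
    by (simp add: det_mul)
  then show ?thesis
    by (simp add: R(2) M_mat_def minor_gram sum_outer_prod_subset)
qed

lemma above_identity_outer_prods: "above_identity (mat 1 + (\<Sum>i\<in>S. outer_prod (column i B)))"
  using above_identity_sum[OF above_identity_mat_1, of S "\<lambda>_. 1" "\<lambda>i. column i B"] by simp

lemma minor_M_mat_pos: "0 < minor M S"
  unfolding M_mat_def minor_gram
  by (intro posdef_det_pos above_identity_posdef above_identity_outer_prods)

lemma det_M_mat_pos: "0 < det M"
  using minor_M_mat_pos[of UNIV] by (simp add: minor_UNIV)

lemma det_add_gram: "det (C + A ** transpose A) = det C * det M"
proof -
  have "diag (\<chi> i. if i \<in> (UNIV :: 'n set) then 1 else 0) = mat 1"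
    by (simp add: diag_def mat_def vec_eq_iff)
  then have "(\<Sum>i\<in>UNIV. outer_prod (column i A)) = A ** transpose A"
    unfolding sum_outer_prod_subset by simp
  then show ?thesis using det_add_outer_prods[of UNIV] by (simp add: minor_UNIV)
qed

lemma z_star_attained:
  assumes "s \<le> CARD('n)"
  obtains S where "card S = s" "z_star C A s = ln (det C) + ln (minor M S)"
    "\<And>T. card T = s \<Longrightarrow> minor M T \<le> minor M S"
proof -
  let ?Z = "(\<lambda>S. ln (det C * minor M S)) ` {S. card S = s}"
  have pos: "0 < det C" by (rule posdef_det_pos[OF C])
  have z: "z_star C A s = Max ?Z"
    by (simp add: z_star_def det_add_outer_prods)
  obtain S0 :: "'n set" where "card S0 = s" using obtain_subset_with_card_n[of s "UNIV :: 'n set"] assms by auto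
  then have "?Z \<noteq> {}" by blast
  then have "Max ?Z \<in> ?Z" by (intro Max_in) auto
  then obtain S where S: "card S = s" "Max ?Z = ln (det C * minor M S)" by auto
  have "minor M T \<le> minor M S" if "card T = s" for T
  proof -
    have "ln (det C * minor M T) \<le> Max ?Z" using that by (intro Max_ge) auto
    then show ?thesis using S(2) pos minor_M_mat_pos by (simp add: ln_mult_pos)
  qed
  then show ?thesis using that S z pos minor_M_mat_pos by (simp add: ln_mult_pos)
qed

lemma obj_R_indicator: "obj_R C A (\<chi> i. if i \<in> S then 1 else 0) = ln (minor M S)"
  unfolding obj_R_def M_mat_def minor_gram sum_outer_prod_columns sum_outer_prod_subset by (rule refl)

text \<open>The squared length of a column is a diagonal entry of B^T B, that is, its quadratic form
  at a unit vector.\<close>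

lemma column_B_mat_le_eigval:
  "column i B \<bullet> column i B \<le> eigval (transpose A ** matrix_inv C ** A) 1"
proof -
  let ?K = "transpose B ** B"
  have "transpose ?K = ?K" by (simp add: matrix_transpose_mul)
  from inner_le_eigval_1[OF this, of "axis i 1"]
  have "axis i 1 \<bullet> (?K *v axis i 1) \<le> eigval ?K 1" by (simp add: inner_axis_axis)
  moreover have "axis i 1 \<bullet> (?K *v axis i 1) = column i B \<bullet> column i B"
    by (metis dot_lmul_matrix matrix_vector_mul_assoc matrix_vector_mult_basis transpose_matrix_vector transpose_transpose)
  ultimately show ?thesis by (simp only: gram_B_mat)
qed

lemma obj_R_le:
  assumes x: "\<And>i. 0 \<le> x $ i \<and> x $ i \<le> 1" and S: "card S = s"
    and \<delta>: "\<delta> = eigval (transpose A ** matrix_inv C ** A) 1"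
  shows "obj_R C A x \<le> ln (minor M S) + real (CARD('n) - s) * ln (1 + \<delta>)"
proof -
  have b: "column i B \<bullet> column i B \<le> \<delta>" for i unfolding \<delta> by (rule column_B_mat_le_eigval)
  then have "0 \<le> \<delta>" using inner_ge_zero order_trans by blast
  let ?P = "\<lambda>T. mat 1 + (\<Sum>i\<in>T. outer_prod (column i B))"
  define Q where "Q = mat 1 + (\<Sum>i\<in>UNIV. x $ i *\<^sub>R outer_prod (column i B))"
  have Q: "above_identity Q"
    unfolding Q_def using x by (intro above_identity_sum above_identity_mat_1) auto
  \<comment> \<open>Raising every weight to 1 cannot lower the determinant. Afterwards each of the n
    - s terms outside \<open>S\<close> accounts for a factor of at most 1 + \<delta>.\<close>
  have "Q + (\<Sum>i\<in>UNIV. (1 - x $ i) *\<^sub>R outer_prod (column i B)) = ?P UNIV"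
    unfolding Q_def by (simp add: algebra_simps flip: sum.distrib)
  moreover have "det Q \<le> det (Q + (\<Sum>i\<in>UNIV. (1 - x $ i) *\<^sub>R outer_prod (column i B)))"
    using det_sum_bounds[OF Q, of UNIV "\<lambda>i. 1 - x $ i" "\<lambda>i. column i B" \<delta>] x b by simp
  ultimately have "det Q \<le> det (?P UNIV)" by simp
  also have "?P UNIV = ?P S + (\<Sum>i\<in>- S. 1 *\<^sub>R outer_prod (column i B))"
    using sum.union_disjoint[of S "- S" "\<lambda>i. outer_prod (column i B)"] by (simp add: Compl_partition add.assoc)
  also have "det \<dots> \<le> det (?P S) * (1 + \<delta>) ^ card (- S)"
    using det_sum_bounds[OF above_identity_outer_prods, of "- S" "\<lambda>_. 1" "\<lambda>i. column i B" \<delta> S] b by simp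
  also have "card (- S) = CARD('n) - s"
    using S by (simp add: Compl_eq_Diff_UNIV card_Diff_subset)
  also have "det (?P S) = minor M S" by (simp add: M_mat_def minor_gram)
  finally have "det Q \<le> minor M S * (1 + \<delta>) ^ (CARD('n) - s)" .
  moreover have "0 < det Q" by (intro posdef_det_pos above_identity_posdef Q)
  ultimately have "ln (det Q) \<le> ln (minor M S * (1 + \<delta>) ^ (CARD('n) - s))"
    by (subst ln_le_cancel_iff) linarith+
  also have "\<dots> = ln (minor M S) + real (CARD('n) - s) * ln (1 + \<delta>)"
    using minor_M_mat_pos[of S] \<open>0 \<le> \<delta>\<close> by (simp add: ln_mult_pos ln_realpow)
  finally show ?thesis by (simp add: obj_R_def Q_def)
qed

end

text \<open>A positive sum forces a nonzero entry, so the minimum is an actual entry. The upper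
  bound makes its logarithm nonpositive.\<close>

lemma min_nonzero_entry_bounds:
  fixes x :: "real^'n"
  assumes "x \<in> feasible s" "0 < s"
  shows "0 < min_nonzero_entry x" "min_nonzero_entry x \<le> 1"
proof -
  let ?Z = "{x $ i | i. x $ i \<noteq> 0}"
  have "?Z \<noteq> {}"
  proof
    assume "?Z = {}"
    then have "\<forall>i. x $ i = 0" by auto
    then show False using assms by (simp add: feasible_def)
  qed
  moreover have "finite ?Z" by (rule finite_subset[of _ "range (\<lambda>i. x $ i)"]) auto
  ultimately have "min_nonzero_entry x \<in> ?Z" unfolding min_nonzero_entry_def by (rule Min_in[rotated])
  then show "0 < min_nonzero_entry x" "min_nonzero_entry x \<le> 1"
    using assms(1) by (auto simp: feasible_def less_le)
qed

theorem corollary17: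
  fixes C :: "real^'d^'d"
    and A :: "real^('n::{finite,linorder})^'d"
    and s :: nat
    and V W :: "real^('n::{finite,linorder})^('n::{finite,linorder})"
    and xD :: "real^('n::{finite,linorder})"
    and x_min \<delta> :: real
  assumes "posdef C"
    and "0 < s" and "s < CARD('n)"
    and "cholesky_factor (M_mat C A) V"
    and "cholesky_factor (matrix_inv (M_mat C A)) W"
    and "is_arg_max (obj_R C A) (\<lambda>x. x \<in> feasible s) xD"
    and "x_min = min_nonzero_entry xD"
    and "\<delta> = eigval (transpose A ** matrix_inv C ** A) 1"
  shows "(z_star C A s \<le> z_R C A s \<and>
          z_R C A s \<le> z_star C A s - real CARD('n) * ln x_min
                       + real (CARD('n) - s) * ln (1 + \<delta>)) \<and>
         (z_star C A s \<le> z_M C V s \<and>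
          z_M C V s \<le> z_star C A s + real s * ln (real s / real CARD('n))
                       + ln (real (CARD('n) choose s))) \<and>
         (z_star C A s \<le> z_Mc C A W s \<and>
          z_Mc C A W s \<le> z_star C A s
                       + real (CARD('n) - s) * ln (real (CARD('n) - s) / real CARD('n))
                       + ln (real (CARD('n) choose (CARD('n) - s))))"
proof (intro conjI)
  note posC = posdef_det_pos[OF assms(1)]
  let ?M = "M_mat C A" and ?n = "CARD('n)"
  note detM = det_M_mat_pos[OF assms(1), of A]
  have sn: "s \<le> ?n" "0 < ?n - s" "?n - s \<le> ?n" using assms(3) by auto
  obtain S where S: "card S = s" and z: "z_star C A s = ln (det C) + ln (minor ?M S)"
    and max: "\<And>T. card T = s \<Longrightarrow> minor ?M T \<le> minor ?M S"
    using z_star_attained[OF assms(1) sn(1)] by blast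
  have cS: "card (- T) = ?n - card T" for T :: "'n set"
    by (simp add: Compl_eq_Diff_UNIV card_Diff_subset)

  \<comment> \<open>The natural relaxation\<close>
  have xD: "xD \<in> feasible s" "\<And>y. y \<in> feasible s \<Longrightarrow> obj_R C A y \<le> obj_R C A xD"
    using assms(6) by (auto simp: is_arg_max_def not_less)
  have zR: "z_R C A s = ln (det C) + obj_R C A xD"
    unfolding z_R_def using max_on_eqI[of xD "feasible s" "obj_R C A"] xD by simp
  show "z_star C A s \<le> z_R C A s"
    using xD(2)[OF indicator_feasible[OF S]] by (simp add: z zR obj_R_indicator[OF assms(1)])
  have "ln x_min \<le> 0"
    using min_nonzero_entry_bounds[OF xD(1) assms(2)] by (simp add: assms(7))
  then have "0 \<le> - real ?n * ln x_min" by (simp add: mult_nonneg_nonpos)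
  moreover have "obj_R C A xD \<le> ln (minor ?M S) + real (?n - s) * ln (1 + \<delta>)"
    by (rule obj_R_le[OF assms(1) _ S assms(8)]) (use xD(1) in \<open>auto simp: feasible_def\<close>)
  ultimately show "z_R C A s \<le> z_star C A s - real ?n * ln x_min + real (?n - s) * ln (1 + \<delta>)"
    by (simp add: z zR)

  \<comment> \<open>The factorization bound\<close>
  have VV: "transpose V ** V = ?M" using assms(4) by (simp add: cholesky_factor_def)
  have "det V * det V = det ?M" unfolding VV[symmetric] by (simp add: det_mul)
  then have V: "det V \<noteq> 0" using detM by auto
  have Vpos: "0 < minor (transpose V ** V) T" for T
    unfolding VV by (rule minor_M_mat_pos[OF assms(1)])
  show "z_star C A s \<le> z_M C V s"
    using ln_minor_le_max_log_f[OF V Vpos assms(2) sn(1) S] by (simp add: z z_M_def VV)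
  show "z_M C V s \<le> z_star C A s + real s * ln (real s / real ?n) + ln (real (?n choose s))"
    using max_log_f_le[OF V Vpos assms(2) sn(1), of "minor ?M S"] max by (simp add: z z_M_def VV)

  \<comment> \<open>The complementary factorization bound\<close>
  have WW: "transpose W ** W = matrix_inv ?M" using assms(5) by (simp add: cholesky_factor_def)
  have inv: "matrix_inv ?M ** ?M = mat 1" using matrix_inv_right_left(2)[of ?M] detM by simp
  \<comment> \<open>Selecting n - s indices for \<open>W\<close> amounts to discarding them for
    \<open>V\<close>, so the optimal \<open>S\<close> enters through its complement. The denominator
    is cancelled by the determinant of C + A A^T, which is det C times det M.\<close>
  have mW: "minor (transpose W ** W) T = minor ?M (- T) / det ?M" for T
    using minor_inverse[OF inv, of T] detM by (simp add: WW field_simps)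
  have Wpos: "0 < minor (transpose W ** W) T" for T
    unfolding mW using minor_M_mat_pos[OF assms(1), of A "- T"] detM by simp
  have "det W * det W = minor (transpose W ** W) UNIV" by (simp add: minor_UNIV det_mul)
  then have W: "det W \<noteq> 0" using Wpos[of UNIV] by auto
  have ln_quot: "ln (minor ?M T / det ?M) = ln (minor ?M T) - ln (det ?M)" for T
    using minor_M_mat_pos[OF assms(1), of A T] detM by (simp add: ln_div)
  have zMc: "z_Mc C A W s = ln (det C) + ln (det ?M) + max_log_f (?n - s) W"
    using posC detM by (simp add: z_Mc_def det_add_gram[OF assms(1)] ln_mult_pos)
  have "ln (minor ?M S / det ?M) \<le> max_log_f (?n - s) W"
    using ln_minor_le_max_log_f[OF W Wpos sn(2,3), of "- S"] S by (simp add: cS mW)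
  then show "z_star C A s \<le> z_Mc C A W s" by (simp add: z zMc ln_quot)
  have "minor (transpose W ** W) T \<le> minor ?M S / det ?M" if "card T = ?n - s" for T
    unfolding mW using max[of "- T"] that assms(3) detM by (simp add: cS divide_right_mono)
  from max_log_f_le[OF W Wpos sn(2,3) this]
  show "z_Mc C A W s \<le> z_star C A s + real (?n - s) * ln (real (?n - s) / real ?n)
      + ln (real (?n choose (?n - s)))"
    by (simp add: z zMc ln_quot)
qed

end
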